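(* Let $K \subset L$ be a field extension with $\operatorname{char}(L)=0$ and $\operatorname{tr\,deg}_K(L) \geq 3$. Suppose that $x,y,z \in \widehat{L}$ are algebraically independent over $\widehat{K}$ and that each of the five sets $\operatorname{acl}_K(x)$, $\operatorname{acl}_K(y)$, $\operatorname{acl}_K(z)$, $\operatorname{acl}_K(x+y)$, $\operatorname{acl}_K(x+z)$ is a point of $\mathbb{G}(L/K)$ (the elements $x,y,z$ themselves need not lie in $L$). Then $$\mathbb{P}((\widehat{L},+): x,y,z) \cap \mathbb{G}(L/K) = \{\operatorname{acl}_K(ax+by+cz) : (a,b,c) \in (\widehat{K}\cap L)^3 \setminus \{\mathbf{0}\}\},$$ and this set is a projective plane in $\mathbb{G}(L/K)$ coordinatised by $\widehat{K}\cap L$. Moreover, it is the largest projective plane in $\mathbb{G}(L/K)$ containing the five points $\operatorname{acl}_K(x), \operatorname{acl}_K(y), \operatorname{acl}_K(z), \operatorname{acl}_K(x+y), \operatorname{acl}_K(x+z)$.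
   Context: Work inside a large algebraically closed field $\mathfrak{C}$; for a subfield $F$, $\widehat{F}$ denotes the algebraic closure of $F$ in $\mathfrak{C}$. For $X \subseteq \mathfrak{C}$, $\operatorname{acl}_K(X) = \widehat{K(X)}$. The combinatorial geometry $\mathbb{G}(L/K)$ has as points the sets $\operatorname{acl}_K(l)$ for $l \in L \setminus \widehat{K}$ (equivalently, $L\setminus\widehat K$ modulo $l\sim l' \iff \widehat{K(l)}=\widehat{K(l')}$), with closure operator induced by $\operatorname{acl}_K$: a point $\operatorname{acl}_K(l_0)$ lies in the closure of points $\operatorname{acl}_K(l_1),\dots,\operatorname{acl}_K(l_n)$ iff $l_0 \in \operatorname{acl}_K(l_1,\dots,l_n)$. Thus $\mathbb{G}(L/K)$ is naturally a subset of $\mathbb{G}(\widehat{L}/\widehat{K})$ (whose points are $\operatorname{acl}_K(u)$, $u \in \widehat L\setminus\widehat K$). Closed sets are sets of the form $\operatorname{acl}_K(Y)$; rank is transcendence degree over $K$; lines are closed sets of rank 2. A subset $X$ of such a geometry is a projective plane if, with the relative closure $Y\mapsto \operatorname{acl}_K(Y)\cap X$, it has rank 3, contains three noncollinear points, every line of $X$ has at least three points, and any two lines of $X$ intersect. A projective plane is coordinatised by a skew field $F$ if it is isomorphic to the projective plane $\mathbb{P}(F)=(F^3\setminus\{0\})/F^{\times}$. For $x,y,z\in\widehat L$ independent over $\widehat K$ (characteristic $0$), $\mathbb{P}((\widehat{L},+): x,y,z) = \{\operatorname{acl}_K(ax+by+cz) : (a,b,c) \in \widehat{K}^3\setminus\{\mathbf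 0\}\}$. *)

theory Defs
  imports
    "HOL-Computational_Algebra.Polynomial"
    "HOL-Library.Poly_Mapping"
    "HOL-Library.Extended_Nat"
    "HOL-Analysis.Finite_Cartesian_Product"
begin

section \<open>Subfields and algebraic closure inside an ambient field\<close>

text \<open>
  The ambient field is the universe of a type of class \<^class>\<open>alg_closed_field\<close>;
  its subfields are sets. In a noncommutative division ring the predicate below
  describes the sub-skew-fields.
\<close>

definition is_subfield :: "'a::division_ring set \<Rightarrow> bool" where
  "is_subfield F \<longleftrightarrow> 0 \<in> F \<and> 1 \<in> F \<and>
     (\<forall>u\<in>F. \<forall>v\<in>F. u + v \<in> F \<and> u * v \<in> F) \<and>
     (\<forall>u\<in>F. - u \<in> F \<and> inverse u \<in> F)"

definition adjoin :: "'a::field set \<Rightarrow> 'a set \<Rightarrow> 'a set" where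
  "adjoin K X = is_subfield hull (K \<union> X)"

definition alg_cl :: "'a::field set \<Rightarrow> 'a set" where
  "alg_cl F = {u. \<exists>p. p \<noteq> 0 \<and> (\<forall>i. coeff p i \<in> F) \<and> poly p u = 0}"

definition acl :: "'a::field set \<Rightarrow> 'a set \<Rightarrow> 'a set" where
  "acl K X = alg_cl (adjoin K X)"


section \<open>Algebraic independence and transcendence degree\<close>

text \<open>
  A multivariate polynomial is a finitely supported function from monomials to
  coefficients, a monomial being a finitely supported exponent function. The
  variables are named by the field elements to be substituted for them, so that
  evaluation replaces the variable named \<open>v\<close> by \<open>v\<close>.
\<close>

definition eval_self :: "(('a::field \<Rightarrow>\<^sub>0 nat) \<Rightarrow>\<^sub>0 'a) \<Rightarrow> 'a" where
  "eval_self p =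
     (\<Sum>m\<in>Poly_Mapping.keys p. Poly_Mapping.lookup p m *
        (\<Prod>v\<in>Poly_Mapping.keys m. v ^ Poly_Mapping.lookup m v))"

definition alg_indep :: "'a::field set \<Rightarrow> 'a set \<Rightarrow> bool" where
  "alg_indep F B \<longleftrightarrow>
     (\<forall>p. (\<forall>m\<in>Poly_Mapping.keys p. Poly_Mapping.keys m \<subseteq> B \<and> Poly_Mapping.lookup p m \<in> F) \<longrightarrow>
          eval_self p = 0 \<longrightarrow> p = 0)"

definition tr_deg :: "'a::field set \<Rightarrow> 'a set \<Rightarrow> enat" where
  "tr_deg K L = (SUP B\<in>{B. B \<subseteq> L \<and> finite B \<and> alg_indep K B}. enat (card B))"


section \<open>The combinatorial geometry of a field extension\<close>

definition geom :: "'a::field set \<Rightarrow> 'a set \<Rightarrow> 'a set set" where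
  "geom K L = {acl K {l} | l. l \<in> L - alg_cl K}"

definition geom_cl :: "'a::field set \<Rightarrow> 'a set \<Rightarrow> 'a set set \<Rightarrow> 'a set set" where
  "geom_cl K L S =
     {acl K {l0} | l0. l0 \<in> L - alg_cl K \<and>
        (\<exists>Y. finite Y \<and> Y \<subseteq> L - alg_cl K \<and> (\<forall>l\<in>Y. acl K {l} \<in> S) \<and> l0 \<in> acl K Y)}"

definition geom_rank :: "'a::field set \<Rightarrow> 'a set set \<Rightarrow> enat" where
  "geom_rank K S = tr_deg K (acl K (\<Union>S))"

text \<open>
  Lines of \<open>X\<close> are taken with respect to the relative closure on \<open>X\<close>: the rank is
  that of the trace on \<open>X\<close>, so a line of the ambient geometry that meets \<open>X\<close>
  in at most one point does not give a line of \<open>X\<close>.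
\<close>

definition lines_of :: "'a::field set \<Rightarrow> 'a set \<Rightarrow> 'a set set \<Rightarrow> 'a set set set" where
  "lines_of K L X = {l. (\<exists>Y\<subseteq>X. l = geom_cl K L Y \<inter> X) \<and> geom_rank K l = 2}"

definition is_proj_plane :: "'a::field set \<Rightarrow> 'a set \<Rightarrow> 'a set set \<Rightarrow> bool" where
  "is_proj_plane K L X \<longleftrightarrow>
     X \<subseteq> geom K L \<and>
     geom_rank K X = 3 \<and>
     (\<exists>p\<in>X. \<exists>q\<in>X. \<exists>r\<in>X. distinct [p, q, r] \<and> \<not> (\<exists>l\<in>lines_of K L X. {p, q, r} \<subseteq> l)) \<and>
     (\<forall>l\<in>lines_of K L X. \<exists>p\<in>l. \<exists>q\<in>l. \<exists>r\<in>l. distinct [p, q, r]) \<and>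
     (\<forall>l\<in>lines_of K L X. \<forall>m\<in>lines_of K L X. l \<inter> m \<noteq> {})"


section \<open>The projective plane over a skew field, and coordinatisation\<close>

text \<open>
  \<open>F\<close> is a sub-skew-field of a division ring and acts on \<open>F\<^sup>3\<close> by multiplication
  from the left.
\<close>

definition proj_pt :: "'f::division_ring set \<Rightarrow> 'f ^ 3 \<Rightarrow> ('f ^ 3) set" where
  "proj_pt F v = {t *s v | t. t \<in> F - {0}}"

definition vecs3 :: "'f set \<Rightarrow> ('f ^ 3) set" where
  "vecs3 F = {v. \<forall>i. v $ i \<in> F}"

definition PG2 :: "'f::division_ring set \<Rightarrow> ('f ^ 3) set set" where
  "PG2 F = proj_pt F ` (vecs3 F - {0})"

definition PG2_lines :: "'f::division_ring set \<Rightarrow> ('f ^ 3) set set set" where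
  "PG2_lines F =
     {proj_pt F ` ({s *s u + t *s v | s t. s \<in> F \<and> t \<in> F} - {0}) | u v.
        u \<in> vecs3 F - {0} \<and> v \<in> vecs3 F - {0} \<and> proj_pt F u \<noteq> proj_pt F v}"

definition coordinatised_by ::
    "'a::field set \<Rightarrow> 'a set \<Rightarrow> 'a set set \<Rightarrow> 'f::division_ring set \<Rightarrow> bool" where
  "coordinatised_by K L X F \<longleftrightarrow>
     is_subfield F \<and>
     (\<exists>f. bij_betw f X (PG2 F) \<and>
          (\<forall>l\<subseteq>X. l \<in> lines_of K L X \<longleftrightarrow> f ` l \<in> PG2_lines F))"


section \<open>The plane of the additive group\<close>

text \<open>
  This is the plane attached to \<open>x\<close>, \<open>y\<close>, \<open>z\<close> in the additive group of the
  algebraic closure of \<open>L\<close>; as a set of points it does not depend on \<open>L\<close>.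
\<close>

definition additive_plane :: "'a::field set \<Rightarrow> 'a \<Rightarrow> 'a \<Rightarrow> 'a \<Rightarrow> 'a set set" where
  "additive_plane K x y z =
     {acl K {a * x + b * y + c * z} | a b c.
        a \<in> alg_cl K \<and> b \<in> alg_cl K \<and> c \<in> alg_cl K \<and> (a, b, c) \<noteq> (0, 0, 0)}"

end

theory Submission
  imports Defs "HOL-Analysis.Cartesian_Space"
begin

text \<open>
  Write \<open>k\<close> for the algebraic closure of \<open>K\<close>. In characteristic 0 an element lies in \<open>acl K S\<close> iff
  every derivation that vanishes on \<open>K \<union> S\<close> vanishes on it. Hence, inside \<open>M = acl K {x, y, z}\<close>,
  the closure operator is linear dependence of the differentials \<open>d w\<close>, and a point becomes a
  one-dimensional subspace of the coordinate space \<open>M\<^sup>3\<close>, its direction.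

  If \<open>l1, ..., l5\<close> in \<open>L\<close> represent the five given points, the last two show that the form
  \<open>a dx + b dy + c dz\<close> is, up to a scalar, rational over \<open>L \<inter> M\<close> in the basis \<open>dl1, dl2, dl3\<close> whenever
  \<open>a, b, c\<close> lie in \<open>k \<inter> L\<close>. The coefficients of the minimal polynomial of \<open>a x + b y + c z\<close> over
  \<open>L \<inter> M\<close> are then killed by all derivations that preserve \<open>L \<inter> M\<close> and kill \<open>a x + b y + c z\<close>;
  the nonconstant ones represent its point by elements of \<open>L\<close>. Conversely, a point of the
  geometry with direction \<open>(a, b, c)\<close> has \<open>L\<close>-rational ratios \<open>a : b : c\<close>.

  For maximality, consider a point of a larger plane with direction \<open>(1, s, 0)\<close>; its slope \<open>s\<close> is
  algebraic over \<open>K(x, y)\<close>. Projecting it from the points of direction \<open>(0, 1, -1)\<close> and \<open>(1, 0, 1)\<close>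
  gives points with directions \<open>(1, 0, s)\<close> and \<open>(0, s, -1)\<close>, so \<open>s\<close> is also algebraic over \<open>K(x, z)\<close>
  and over \<open>K(y, z)\<close>, hence constant. Every other point reduces to this case by further projections.
\<close>

section \<open>Extension of derivations\<close>

definition derivation :: "('a::comm_ring_1 \<Rightarrow> 'a) \<Rightarrow> bool" where
  "derivation D \<longleftrightarrow> (\<forall>a b. D (a + b) = D a + D b) \<and> (\<forall>a b. D (a * b) = a * D b + D a * b)"

text \<open>A derivation is encoded by its graph, read as a subring of the dual numbers.\<close>

definition derivation_graph :: "('a::comm_ring_1 \<times> 'a) set \<Rightarrow> bool" where
  "derivation_graph G \<longleftrightarrow> (1, 0) \<in> G \<and>
     (\<forall>a a' b b'. (a, a') \<in> G \<longrightarrow> (b, b') \<in> G \<longrightarrow>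
        (a + b, a' + b') \<in> G \<and> (a * b, a * b' + a' * b) \<in> G) \<and>
     (\<forall>a a'. (a, a') \<in> G \<longrightarrow> (- a, - a') \<in> G) \<and>
     (\<forall>a'. (0, a') \<in> G \<longrightarrow> a' = 0)"

lemma derivation_graphD:
  assumes "derivation_graph G"
  shows "(1, 0) \<in> G" "(0, 0) \<in> G"
    and "\<And>a a' b b'. (a, a') \<in> G \<Longrightarrow> (b, b') \<in> G \<Longrightarrow> (a + b, a' + b') \<in> G"
    and "\<And>a a' b b'. (a, a') \<in> G \<Longrightarrow> (b, b') \<in> G \<Longrightarrow> (a * b, a * b' + a' * b) \<in> G"
    and "\<And>a a'. (a, a') \<in> G \<Longrightarrow> (- a, - a') \<in> G"
    and "\<And>a'. (0, a') \<in> G \<Longrightarrow> a' = 0"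
proof -
  show 1: "(1, 0) \<in> G"
    and 2: "\<And>a a' b b'. (a, a') \<in> G \<Longrightarrow> (b, b') \<in> G \<Longrightarrow> (a + b, a' + b') \<in> G"
    and "\<And>a a' b b'. (a, a') \<in> G \<Longrightarrow> (b, b') \<in> G \<Longrightarrow> (a * b, a * b' + a' * b) \<in> G"
    and 3: "\<And>a a'. (a, a') \<in> G \<Longrightarrow> (- a, - a') \<in> G"
    and "\<And>a'. (0, a') \<in> G \<Longrightarrow> a' = 0"
    using assms unfolding derivation_graph_def by blast+
  show "(0, 0) \<in> G"
    using 2[OF 1 3[OF 1]] by simp
qed

lemma derivation_graph_sum:
  assumes "derivation_graph G" and "\<And>i. i \<in> I \<Longrightarrow> (a i, a' i) \<in> G"
  shows "(sum a I, sum a' I) \<in> G"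
  using assms(2)
  by (induction I rule: infinite_finite_induct) (auto intro: derivation_graphD[OF assms(1)])

lemma derivation_graph_unique:
  assumes "derivation_graph G" "(a, b) \<in> G" "(a, c) \<in> G"
  shows "b = c"
  using derivation_graphD(6)[OF assms(1), of "b + - c"]
    derivation_graphD(3)[OF assms(1,2) derivation_graphD(5)[OF assms(1,3)]] by simp

lemma exists_min_degree_poly:
  fixes P :: "'a::zero poly \<Rightarrow> bool"
  assumes "P p"
  obtains q where "P q" "\<And>r. P r \<Longrightarrow> degree q \<le> degree r"
  using assms exists_least_iff[of "\<lambda>n. \<exists>q. P q \<and> degree q = n"] by (metis leI)

text \<open>
  The extension of \<open>G\<close> to \<open>u\<close> consists of the pairs \<open>(f(u), f\<^sup>D(u) + f'(u) d)\<close>, where \<open>f\<close> has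
  coefficients in the domain and \<open>f\<^sup>D\<close> arises by applying the derivation to the coefficients. It is
  single-valued as soon as one relation of least degree over the domain is respected.
\<close>

lemma derivation_graph_adjoin:
  fixes G :: "('a::field_char_0 \<times> 'a) set"
  assumes G: "derivation_graph G"
  obtains H d where "derivation_graph H" "G \<subseteq> H" "(u, d) \<in> H"
proof -
  note Gs = derivation_graphD[OF G]
  define C where "C f h \<longleftrightarrow> (\<forall>i. (coeff f i, coeff h i) \<in> G)" for f h :: "'a poly"
  define \<Delta> where "\<Delta> d f h = poly h u + poly (pderiv f) u * d" for d f h
  have C_add: "C (f + g) (h + k)" and C_mult: "C (f * g) (f * k + h * g)" and C_minus: "C (- f) (- h)"
    if "C f h" "C g k" for f g h k
  proof -
    show "C (f + g) (h + k)" "C (- f) (- h)"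
      using that unfolding C_def by (auto intro: Gs)
    show "C (f * g) (f * k + h * g)"
      using that unfolding C_def coeff_mult coeff_add sum.distrib[symmetric]
      by (auto intro!: derivation_graph_sum[OF G] Gs)
  qed
  have C_monom: "C (monom a n) (monom b n)" if "(a, b) \<in> G" for a b n
    using that Gs unfolding C_def by auto
  have \<Delta>_mult: "\<Delta> d (f * g) (f * k + h * g) = poly f u * \<Delta> d g k + \<Delta> d f h * poly g u" for d f g h k
    unfolding \<Delta>_def by (simp add: pderiv_mult algebra_simps)
  have \<Delta>_diff: "\<Delta> d (f + - g) (h + - k) = \<Delta> d f h - \<Delta> d g k" for d f g h k
    unfolding \<Delta>_def by (simp add: pderiv_diff algebra_simps)
  have C_0: "h = 0" if "C 0 h" for h
    using that Gs(6) unfolding C_def by (auto intro: poly_eqI)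
  \<comment> \<open>The derivative \<open>d\<close> of \<open>u\<close> only has to respect the
    relations of \<open>u\<close> over the domain; if there are none, 0 serves.\<close>
  have "\<exists>d. \<forall>f h. C f h \<longrightarrow> poly f u = 0 \<longrightarrow> \<Delta> d f h = 0"
  proof (cases "\<exists>f h. C f h \<and> poly f u = 0 \<and> f \<noteq> 0")
    case False
    then show ?thesis
      by (intro exI[of _ 0]) (auto simp: \<Delta>_def dest!: C_0)
  next
    case True
    then obtain f1 h1 where f1h1: "C f1 h1" "poly f1 u = 0" "f1 \<noteq> 0" by blast
    obtain f0 where f0: "\<exists>h. C f0 h \<and> poly f0 u = 0 \<and> f0 \<noteq> 0"
      and min: "\<And>r. \<exists>h. C r h \<and> poly r u = 0 \<and> r \<noteq> 0 \<Longrightarrow> degree f0 \<le> degree r"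
      using f1h1 by (rule_tac exists_min_degree_poly[of "\<lambda>f. \<exists>h. C f h \<and> poly f u = 0 \<and> f \<noteq> 0" f1]) auto
    from f0 obtain h0 where h0: "C f0 h0" and f0u: "poly f0 u = 0" and f00: "f0 \<noteq> 0" by blast
    have deg: "degree f0 \<noteq> 0"
    proof
      assume "degree f0 = 0"
      then obtain c where "f0 = [:c:]" by (rule degree_eq_zeroE)
      with f0u f00 show False by simp
    qed
    \<comment> \<open>Natural numbers are constants, so \<open>pderiv f0\<close> again has
      coefficients in the domain.\<close>
    have nat: "(of_nat n, 0) \<in> G" for n
    proof (induction n)
      case (Suc n)
      with Gs(3)[OF Gs(1) this] show ?case by simp
    qed (use Gs(2) in simp)
    have "C (pderiv f0) (pderiv h0)"
      using h0 Gs(4)[OF nat, of "coeff f0 (Suc i)" "coeff h0 (Suc i)" "Suc i" for i]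
      unfolding C_def coeff_pderiv by simp
    moreover have "pderiv f0 \<noteq> 0" "degree (pderiv f0) < degree f0"
      using deg by (auto simp: pderiv_eq_0_iff degree_pderiv)
    ultimately have nz: "poly (pderiv f0) u \<noteq> 0"
      using min[of "pderiv f0"] by auto
    \<comment> \<open>The relation \<open>f0\<close> forces this value: it solves
      \<open>\<Delta> d f0 h0 = 0\<close>.\<close>
    define d where "d = - poly h0 u / poly (pderiv f0) u"
    have d0: "\<Delta> d f0 h0 = 0"
      using nz unfolding \<Delta>_def d_def by simp
    have "\<Delta> d f h = 0" if "C f h" "poly f u = 0" for f h
      using that
    proof (induction "degree f" arbitrary: f h rule: less_induct)
      case less
      show ?case
      proof (cases "f = 0")
        case True
        with C_0[of h] less.prems show ?thesis by (simp add: \<Delta>_def)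
      next
        case False
        then have le: "degree f0 \<le> degree f"
          using min less.prems by blast
        let ?m = "degree f - degree f0"
        let ?a = "lead_coeff f0" and ?a' = "coeff h0 (degree f0)"
        let ?b = "lead_coeff f" and ?b' = "coeff h (degree f)"
        let ?A = "monom ?a 0" and ?A' = "monom ?a' 0"
        let ?B = "monom ?b ?m" and ?B' = "monom ?b' ?m"
        \<comment> \<open>Pseudo-division: the domain is only a ring, so the leading coefficients
          are cross-multiplied to cancel the top term. \<open>?k\<close> is the coefficientwise
          derivative of \<open>?g\<close>.\<close>
        let ?g = "?A * f + - (?B * f0)"
        let ?k = "?A * h + ?A' * f + - (?B * h0 + ?B' * f0)"
        have CA: "C ?A ?A'"
          using h0 by (intro C_monom) (simp add: C_def)
        have CB: "C ?B ?B'"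
          using less.prems(1) by (intro C_monom) (simp add: C_def)
        have Cg: "C ?g ?k"
          using C_add[OF C_mult[OF CA less.prems(1)] C_minus[OF C_mult[OF CB h0] h0]] .
        have gu: "poly ?g u = 0"
          using less.prems f0u by simp
        have "?g = 0 \<or> degree ?g < degree f"
        proof (cases "?g = 0")
          case False
          have "coeff ?g (degree f) = 0"
            using le by (simp add: coeff_monom_mult)
          moreover have "degree (?B * f0) \<le> degree f"
            using degree_mult_le[of ?B f0] degree_monom_le[of ?b ?m] le by linarith
          then have "degree ?g \<le> degree f"
            by (intro degree_add_le) (simp_all add: monom_0)
          ultimately show ?thesis
            using False by (metis leading_coeff_0_iff le_neq_implies_less)
        qed simp
        then have "\<Delta> d ?g ?k = 0"
        proof
          assume "?g = 0"
          with C_0 Cg have "?k = 0" by metis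
          show ?thesis unfolding \<open>?g = 0\<close> \<open>?k = 0\<close> \<Delta>_def by simp
        qed (use less.hyps Cg gu in blast)
        moreover have "\<Delta> d ?g ?k = \<Delta> d (?A * f) (?A * h + ?A' * f) - \<Delta> d (?B * f0) (?B * h0 + ?B' * f0)"
          by (rule \<Delta>_diff)
        ultimately have "?a * \<Delta> d f h = 0"
          unfolding \<Delta>_mult using d0 f0u less.prems by (simp add: poly_monom)
        with f00 show ?thesis by simp
      qed
    qed
    then show ?thesis by blast
  qed
  then obtain d where d: "\<And>f h. C f h \<Longrightarrow> poly f u = 0 \<Longrightarrow> \<Delta> d f h = 0" by blast
  define H where "H = {(poly f u, \<Delta> d f h) | f h. C f h}"
  have mono: "G \<subseteq> H"
  proof clarify
    fix a b assume "(a, b) \<in> G"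
    then have "C (monom a 0) (monom b 0)" by (rule C_monom)
    then show "(a, b) \<in> H"
      unfolding H_def \<Delta>_def mem_Collect_eq
      by (intro exI[of _ "monom a 0"] exI[of _ "monom b 0"]) (simp add: poly_monom pderiv_monom)
  qed
  have "derivation_graph H"
    unfolding derivation_graph_def
  proof (intro conjI allI impI)
    show "(1, 0) \<in> H" using mono Gs(1) by blast
  next
    fix a' assume "(0, a') \<in> H"
    then show "a' = 0" using d unfolding H_def by auto
  next
    fix a a' assume "(a, a') \<in> H"
    then obtain f h where "C f h" "a = poly f u" "a' = \<Delta> d f h" unfolding H_def by blast
    then show "(- a, - a') \<in> H"
      unfolding H_def mem_Collect_eq
      by (intro exI[of _ "- f"] exI[of _ "- h"]) (use C_minus in \<open>auto simp: \<Delta>_def pderiv_minus\<close>)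
  next
    fix a a' b b' assume "(a, a') \<in> H" "(b, b') \<in> H"
    then obtain f h g k where *: "C f h" "a = poly f u" "a' = \<Delta> d f h"
      "C g k" "b = poly g u" "b' = \<Delta> d g k" unfolding H_def by blast
    show "(a + b, a' + b') \<in> H"
      unfolding H_def mem_Collect_eq
      by (intro exI[of _ "f + g"] exI[of _ "h + k"])
        (use C_add * in \<open>auto simp: \<Delta>_def pderiv_add algebra_simps\<close>)
    show "(a * b, a * b' + a' * b) \<in> H"
      unfolding H_def mem_Collect_eq
      by (intro exI[of _ "f * g"] exI[of _ "f * k + h * g"])
        (use C_mult * \<Delta>_mult in auto)
  qed
  moreover have "(u, d) \<in> H"
  proof -
    have "C (monom 1 1) 0"
      unfolding C_def using Gs(1,2) by simp
    then show ?thesis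
      unfolding H_def \<Delta>_def mem_Collect_eq
      by (intro exI[of _ "monom 1 1"] exI[of _ 0]) (simp add: poly_monom pderiv_monom)
  qed
  ultimately show ?thesis using that mono by blast
qed

text \<open>Zorn's lemma yields a maximal graph; by \<open>derivation_graph_adjoin\<close> its
  domain is the whole field.\<close>

lemma derivation_extension:
  fixes G :: "('a::field_char_0 \<times> 'a) set"
  assumes "derivation_graph G"
  obtains D where "derivation D" "\<And>a b. (a, b) \<in> G \<Longrightarrow> D a = b"
proof -
  define \<A> where "\<A> = {H. derivation_graph H \<and> G \<subseteq> H}"
  have "\<exists>M\<in>\<A>. \<forall>X\<in>\<A>. M \<subseteq> X \<longrightarrow> X = M"
  proof (rule subset_Zorn_nonempty)
    show "\<A> \<noteq> {}" using assms unfolding \<A>_def by blast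
  next
    fix \<C> assume ne: "\<C> \<noteq> {}" and ch: "subset.chain \<A> \<C>"
    have sub: "derivation_graph H" "G \<subseteq> H" if "H \<in> \<C>" for H
      using ch that unfolding subset.chain_def \<A>_def by auto
    have two: "\<exists>H\<in>\<C>. p \<in> H \<and> q \<in> H" if pq: "p \<in> \<Union>\<C>" "q \<in> \<Union>\<C>" for p q
    proof -
      from pq obtain H1 H2 where "H1 \<in> \<C>" "p \<in> H1" "H2 \<in> \<C>" "q \<in> H2" by blast
      moreover from this have "H1 \<subseteq> H2 \<or> H2 \<subseteq> H1"
        using ch unfolding subset.chain_def by blast
      ultimately show ?thesis by blast
    qed
    have "derivation_graph (\<Union>\<C>)"
      unfolding derivation_graph_def
    proof (intro conjI allI impI)
      show "(1, 0) \<in> \<Union>\<C>" using ne sub derivation_graphD(1) by blast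
    next
      fix a' assume "(0, a') \<in> \<Union>\<C>"
      then show "a' = 0" using sub derivation_graphD(6) by blast
    next
      fix a a' assume "(a, a') \<in> \<Union>\<C>"
      then show "(- a, - a') \<in> \<Union>\<C>" using sub derivation_graphD(5) by blast
    next
      fix a a' b b' assume "(a, a') \<in> \<Union>\<C>" "(b, b') \<in> \<Union>\<C>"
      from two[OF this] obtain H where H: "H \<in> \<C>" "(a, a') \<in> H" "(b, b') \<in> H" by blast
      show "(a + b, a' + b') \<in> \<Union>\<C>" "(a * b, a * b' + a' * b) \<in> \<Union>\<C>"
        using H derivation_graphD(3,4)[OF sub(1)[OF H(1)] H(2,3)] by blast+
    qed
    with ne sub show "\<Union>\<C> \<in> \<A>" unfolding \<A>_def by blast
  qed
  then obtain M where M: "M \<in> \<A>" and M_max: "\<forall>X\<in>\<A>. M \<subseteq> X \<longrightarrow> X = M" ..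
  then have M: "derivation_graph M" "G \<subseteq> M"
    unfolding \<A>_def by auto
  with M_max have max: "X = M" if "derivation_graph X" "M \<subseteq> X" for X
    using that unfolding \<A>_def by auto
  have "\<exists>d. (u, d) \<in> M" for u
    using derivation_graph_adjoin[OF M(1), of u] max by metis
  then obtain D where D: "\<And>u. (u, D u) \<in> M" by metis
  have eq: "D a = b" if "(a, b) \<in> M" for a b
    using derivation_graph_unique[OF M(1) D that] .
  have "derivation D"
    unfolding derivation_def using eq derivation_graphD(3,4)[OF M(1) D D] by metis
  then show ?thesis using eq M(2) by (intro that) auto
qed

section \<open>Derivations and algebraic closure\<close>

lemma derivationD:
  assumes "derivation D"
  shows "D (a + b) = D a + D b" "D (a * b) = a * D b + D a * b" "D 0 = 0" "D 1 = 0"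
    "D (- a) = - D a" "D (a - b) = D a - D b"
proof -
  show 1: "D (a + b) = D a + D b" and 3: "D (a * b) = a * D b + D a * b" for a b
    using assms unfolding derivation_def by simp_all
  show 0: "D 0 = 0" using 1[of 0 0] by simp
  show "D 1 = 0" using 3[of 1 1] by simp
  show 2: "D (- a) = - D a" for a using 1[of a "- a"] 0 by (simp add: add_eq_0_iff)
  show "D (a - b) = D a - D b" using 1[of a "- b"] 2 by simp
qed

lemma derivation_inverse:
  fixes D :: "'a::field \<Rightarrow> 'a"
  assumes "derivation D"
  shows "D (inverse a) = - D a * inverse a * inverse a"
proof (cases "a = 0")
  case False
  then have "0 = a * D (inverse a) + D a * inverse a"
    using derivationD(2)[OF assms, of a "inverse a"] derivationD(4)[OF assms] by simp
  with False show ?thesis by (simp add: field_simps add_eq_0_iff)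
qed (simp add: derivationD(3)[OF assms])

lemma derivation_sum:
  assumes "derivation D"
  shows "D (sum f I) = (\<Sum>i\<in>I. D (f i))"
  by (induction I rule: infinite_finite_induct) (simp_all add: derivationD[OF assms])

lemma derivation_poly:
  fixes D :: "'a::field_char_0 \<Rightarrow> 'a"
  assumes "derivation D"
  shows "D (poly p u) = poly (map_poly D p) u + poly (pderiv p) u * D u"
  by (induction p) (simp_all add: derivationD[OF assms] map_poly_pCons pderiv_pCons algebra_simps)

section \<open>Subfields, adjunction and minimal relations\<close>

lemma is_subfieldD:
  assumes "is_subfield F"
  shows "0 \<in> F" "1 \<in> F" "u \<in> F \<Longrightarrow> v \<in> F \<Longrightarrow> u + v \<in> F" "u \<in> F \<Longrightarrow> v \<in> F \<Longrightarrow> u * v \<in> F"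
    "u \<in> F \<Longrightarrow> - u \<in> F" "u \<in> F \<Longrightarrow> inverse u \<in> F" "u \<in> F \<Longrightarrow> v \<in> F \<Longrightarrow> u - v \<in> F"
proof -
  show "0 \<in> F" "1 \<in> F" and 1: "u \<in> F \<Longrightarrow> v \<in> F \<Longrightarrow> u + v \<in> F" and "u \<in> F \<Longrightarrow> v \<in> F \<Longrightarrow> u * v \<in> F"
    and 2: "u \<in> F \<Longrightarrow> - u \<in> F" and "u \<in> F \<Longrightarrow> inverse u \<in> F" for u v
    using assms unfolding is_subfield_def by simp_all
  show "u \<in> F \<Longrightarrow> v \<in> F \<Longrightarrow> u - v \<in> F"
    using 1[of u "- v"] 2[of v] by simp
qed

lemma is_subfield_divide:
  fixes F :: "'a::field set"
  shows "is_subfield F \<Longrightarrow> u \<in> F \<Longrightarrow> v \<in> F \<Longrightarrow> u / v \<in> F"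
  unfolding divide_inverse by (intro is_subfieldD)

lemma is_subfield_power: "is_subfield F \<Longrightarrow> u \<in> F \<Longrightarrow> u ^ n \<in> F"
  by (induction n) (auto intro: is_subfieldD)

lemma is_subfield_sum: "is_subfield F \<Longrightarrow> (\<And>i. i \<in> I \<Longrightarrow> f i \<in> F) \<Longrightarrow> sum f I \<in> F"
  by (induction I rule: infinite_finite_induct) (auto intro: is_subfieldD)

lemma is_subfield_of_nat: "is_subfield F \<Longrightarrow> of_nat n \<in> F"
  by (induction n) (auto intro: is_subfieldD)

lemma is_subfield_poly:
  fixes F :: "'a::field set"
  shows "is_subfield F \<Longrightarrow> (\<And>i. coeff p i \<in> F) \<Longrightarrow> u \<in> F \<Longrightarrow> poly p u \<in> F"
  unfolding poly_altdef by (intro is_subfield_sum is_subfieldD(4) is_subfield_power) auto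

lemma is_subfield_pderiv:
  "is_subfield F \<Longrightarrow> (\<And>i. coeff p i \<in> F) \<Longrightarrow> coeff (pderiv (p :: 'a::field poly)) i \<in> F"
  unfolding coeff_pderiv by (intro is_subfieldD(4) is_subfield_of_nat) auto

lemma is_subfield_Inter: "(\<And>F. F \<in> \<F> \<Longrightarrow> is_subfield F) \<Longrightarrow> is_subfield (\<Inter>\<F>)"
  unfolding is_subfield_def[of "\<Inter>\<F>"] by (auto simp: is_subfieldD)

lemma is_subfield_adjoin: "is_subfield (adjoin K X)"
  unfolding adjoin_def by (rule hull_in) (simp add: is_subfield_Inter)

lemma adjoin_superset: "K \<subseteq> adjoin K X" "X \<subseteq> adjoin K X"
  using hull_subset[of "K \<union> X" is_subfield] unfolding adjoin_def by auto

lemma adjoin_least: "is_subfield F \<Longrightarrow> K \<subseteq> F \<Longrightarrow> X \<subseteq> F \<Longrightarrow> adjoin K X \<subseteq> F"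
  unfolding adjoin_def by (intro hull_minimal) auto

lemma alg_cl_superset: "is_subfield F \<Longrightarrow> F \<subseteq> alg_cl F"
proof
  fix u assume F: "is_subfield F" and "u \<in> F"
  then have "\<forall>i. coeff [:- u, 1:] i \<in> F"
    by (auto simp: coeff_pCons is_subfieldD split: nat.splits)
  then show "u \<in> alg_cl F"
    unfolding alg_cl_def by (intro CollectI exI[of _ "[:- u, 1:]"]) auto
qed

text \<open>Minimality of the degree makes the relation separable in characteristic 0.\<close>

lemma minimal_relation:
  fixes F :: "'a::field_char_0 set"
  assumes F: "is_subfield F" and "u \<in> alg_cl F"
  obtains p where "\<And>i. coeff p i \<in> F" "poly p u = 0" "lead_coeff p = 1" "poly (pderiv p) u \<noteq> 0"
    "\<And>q. (\<And>i. coeff q i \<in> F) \<Longrightarrow> poly q u = 0 \<Longrightarrow> degree q < degree p \<Longrightarrow> q = 0"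
proof -
  define R where "R p \<longleftrightarrow> (\<forall>i. coeff p i \<in> F) \<and> poly p u = 0 \<and> p \<noteq> 0" for p
  obtain p0 where "R p0"
    using assms unfolding alg_cl_def R_def by blast
  then obtain q where q: "R q" "\<And>r. R r \<Longrightarrow> degree q \<le> degree r"
    by (rule exists_min_degree_poly) (rule that)
  \<comment> \<open>With a monic relation every derivation kills the leading coefficient, so
    applying it to the coefficients lowers the degree; this is exploited later.\<close>
  define p where "p = smult (inverse (lead_coeff q)) q"
  have p: "R p" "degree p = degree q" "lead_coeff p = 1"
    using q(1) F unfolding R_def p_def by (auto intro: is_subfieldD)
  have small: "r = 0" if "\<And>i. coeff r i \<in> F" "poly r u = 0" "degree r < degree p" for r
    using q(2)[of r] p(2) that unfolding R_def by auto
  have "degree p \<noteq> 0"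
  proof
    assume "degree p = 0"
    then obtain c where "p = [:c:]" by (rule degree_eq_zeroE)
    with p(1) show False unfolding R_def by simp
  qed
  then have "poly (pderiv p) u \<noteq> 0"
    using small[of "pderiv p"] is_subfield_pderiv[OF F, of p] p(1)
    by (auto simp: R_def degree_pderiv pderiv_eq_0_iff)
  then show ?thesis
    using small p unfolding R_def by (intro that[of p]) auto
qed

text \<open>Differentiating a separable relation \<open>p\<close> of \<open>u\<close> over
  \<open>E\<close> gives a linear equation for \<open>D u\<close> over \<open>F\<close>, in which
  \<open>D u\<close> has the nonzero coefficient \<open>p'(u)\<close>.\<close>

lemma derivation_preserves:
  fixes D :: "'a::field_char_0 \<Rightarrow> 'a"
  assumes D: "derivation D" and E: "is_subfield E" and F: "is_subfield F" and "E \<subseteq> F"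
    and DE: "\<And>a. a \<in> E \<Longrightarrow> D a \<in> E" and u: "u \<in> F" "u \<in> alg_cl E"
  shows "D u \<in> F"
proof -
  obtain p where p: "\<And>i. coeff p i \<in> E" "poly p u = 0" "poly (pderiv p) u \<noteq> 0"
    by (rule minimal_relation[OF E u(2)]) (rule that)
  have "coeff (map_poly D p) i \<in> F" for i
    using DE p(1) \<open>E \<subseteq> F\<close> by (auto simp: coeff_map_poly derivationD[OF D])
  moreover have "coeff (pderiv p) i \<in> F" for i
    using is_subfield_pderiv[OF E p(1)] \<open>E \<subseteq> F\<close> by blast
  moreover have "D u = - poly (map_poly D p) u / poly (pderiv p) u"
    using derivation_poly[OF D, of p u] p(2,3) derivationD(3)[OF D] by (simp add: field_simps add_eq_0_iff)
  ultimately show ?thesis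
    using u(1) F by (simp add: is_subfield_divide is_subfield_poly is_subfieldD)
qed

section \<open>Derivations over \<open>K\<close> as a test for algebraic dependence\<close>

definition ders :: "'a::field set \<Rightarrow> ('a \<Rightarrow> 'a) set" where
  "ders K = {D. derivation D \<and> (\<forall>c\<in>K. D c = 0)}"

lemma dersD: "D \<in> ders K \<Longrightarrow> derivation D" "D \<in> ders K \<Longrightarrow> c \<in> K \<Longrightarrow> D c = 0"
  unfolding ders_def by auto

lemma ders_lincomb:
  "(\<And>i. i \<in> I \<Longrightarrow> D i \<in> ders K) \<Longrightarrow> (\<lambda>w. \<Sum>i\<in>I. c i * D i w) \<in> ders K"
  unfolding ders_def derivation_def
  by (auto simp: sum.distrib algebra_simps sum_distrib_left intro!: sum.neutral)

lemma derivation_kernel_subfield: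
  fixes D :: "'a::field \<Rightarrow> 'a"
  shows "derivation D \<Longrightarrow> is_subfield {w. D w = 0}"
  unfolding is_subfield_def by (auto simp: derivationD derivation_inverse)

text \<open>The coefficients are constants, so differentiating a separable relation leaves only
  \<open>p'(u) D u = 0\<close>.\<close>

lemma ders_alg_cl:
  fixes D :: "'a::field_char_0 \<Rightarrow> 'a"
  assumes D: "D \<in> ders F" and F: "is_subfield F" and "u \<in> alg_cl F"
  shows "D u = 0"
proof -
  obtain p where p: "\<And>i. coeff p i \<in> F" "poly p u = 0" "poly (pderiv p) u \<noteq> 0"
    by (rule minimal_relation[OF F assms(3)]) (rule that)
  have "map_poly D p = 0"
    using p(1) dersD[OF D] by (intro poly_eqI) (simp add: coeff_map_poly derivationD)
  then show ?thesis
    using derivation_poly[OF dersD(1)[OF D], of p u] p(2,3) derivationD(3)[OF dersD(1)[OF D]] by simp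
qed

text \<open>This is \<open>d/du\<close> on \<open>F[u]\<close>, well-defined because
  \<open>u\<close> is transcendental, extended to the whole field.\<close>

lemma transcendental_derivation:
  fixes F :: "'a::field_char_0 set"
  assumes F: "is_subfield F" and u: "u \<notin> alg_cl F"
  obtains D where "D \<in> ders F" "D u = 1"
proof -
  let ?C = "\<lambda>f. \<forall>i. coeff f i \<in> F"
  define G where "G = {(poly f u, poly (pderiv f) u) | f. ?C f}"
  have *: "(poly f u, poly (pderiv f) u) \<in> G" if "?C f" for f
    using that unfolding G_def by blast
  have "derivation_graph G"
    unfolding derivation_graph_def
  proof (intro conjI allI impI)
    show "(1, 0) \<in> G"
      using *[of 1] F by (auto simp: is_subfieldD coeff_1)
  next
    fix a' assume "(0, a') \<in> G"
    then obtain f where f: "?C f" "poly f u = 0" "a' = poly (pderiv f) u" unfolding G_def by auto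
    then have "f = 0" using u unfolding alg_cl_def by blast
    with f show "a' = 0" by simp
  next
    fix a a' assume "(a, a') \<in> G"
    then obtain f where "?C f" "a = poly f u" "a' = poly (pderiv f) u" unfolding G_def by blast
    then show "(- a, - a') \<in> G"
      using *[of "- f"] F by (simp add: pderiv_minus is_subfieldD)
  next
    fix a a' b b' assume "(a, a') \<in> G" "(b, b') \<in> G"
    then obtain f g where fg: "?C f" "a = poly f u" "a' = poly (pderiv f) u"
      "?C g" "b = poly g u" "b' = poly (pderiv g) u" unfolding G_def by blast
    show "(a + b, a' + b') \<in> G"
      using *[of "f + g"] F fg by (simp add: pderiv_add is_subfieldD)
    have "?C (f * g)"
      using F fg by (auto simp: coeff_mult intro!: is_subfield_sum is_subfieldD)
    then show "(a * b, a * b' + a' * b) \<in> G"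
      using *[of "f * g"] fg by (simp add: pderiv_mult algebra_simps)
  qed
  then obtain D where D: "derivation D" "\<And>a b. (a, b) \<in> G \<Longrightarrow> D a = b"
    by (rule derivation_extension) (rule that)
  have "D c = 0" if "c \<in> F" for c
    using D(2) *[of "[:c:]"] that F by (auto simp: coeff_pCons is_subfieldD split: nat.splits)
  moreover have "D u = 1"
    using D(2) *[of "[:0, 1:]"] F by (auto simp: coeff_pCons is_subfieldD pderiv_pCons split: nat.splits)
  ultimately show ?thesis using D(1) by (intro that[of D]) (auto simp: ders_def)
qed

text \<open>The kernel of a derivation is a subfield and contains whatever is algebraic over it.
  Conversely, an element \<open>w\<close> outside the closure admits the derivation
  \<open>d/dw\<close> over \<open>adjoin K S\<close>.\<close>

lemma acl_iff_ders:
  fixes K :: "'a::field_char_0 set"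
  shows "w \<in> acl K S \<longleftrightarrow> (\<forall>D\<in>ders K. (\<forall>s\<in>S. D s = 0) \<longrightarrow> D w = 0)"
proof
  assume w: "w \<in> acl K S"
  show "\<forall>D\<in>ders K. (\<forall>s\<in>S. D s = 0) \<longrightarrow> D w = 0"
  proof (intro ballI impI)
    fix D assume D: "D \<in> ders K" and "\<forall>s\<in>S. D s = 0"
    then have "adjoin K S \<subseteq> {w. D w = 0}"
      by (intro adjoin_least derivation_kernel_subfield) (auto simp: dersD)
    with D have "D \<in> ders (adjoin K S)" unfolding ders_def by auto
    then show "D w = 0"
      using ders_alg_cl[OF _ is_subfield_adjoin] w unfolding acl_def by blast
  qed
next
  assume *: "\<forall>D\<in>ders K. (\<forall>s\<in>S. D s = 0) \<longrightarrow> D w = 0"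
  show "w \<in> acl K S"
  proof (rule ccontr)
    assume "w \<notin> acl K S"
    then have "w \<notin> alg_cl (adjoin K S)" unfolding acl_def .
    then obtain D where D: "D \<in> ders (adjoin K S)" "D w = 1"
      by (rule transcendental_derivation[OF is_subfield_adjoin])
    have "D \<in> ders K"
      using D(1) adjoin_superset(1)[of K S] unfolding ders_def by auto
    moreover have "\<forall>s\<in>S. D s = 0"
      using D(1) adjoin_superset(2)[of S K] unfolding ders_def by auto
    ultimately show False using * D(2) by auto
  qed
qed

text \<open>The closure is an intersection of kernels, so no polynomials for sums and products of
  algebraic elements have to be constructed.\<close>

lemma is_subfield_acl: "is_subfield (acl K S)" for K :: "'a::field_char_0 set"
proof -
  have "acl K S = \<Inter>((\<lambda>D. {w. D w = 0}) ` {D \<in> ders K. \<forall>s\<in>S. D s = 0})"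
    by (auto simp: acl_iff_ders)
  moreover have "is_subfield \<dots>"
    by (rule is_subfield_Inter) (auto simp: derivation_kernel_subfield dersD(1))
  ultimately show ?thesis by simp
qed

lemma alg_cl_eq_acl:
  fixes K :: "'a::field_char_0 set"
  assumes "is_subfield K"
  shows "alg_cl K = acl K {}"
  using adjoin_superset(1)[of K "{}"] adjoin_least[OF assms, of K "{}"]
  unfolding acl_def by auto

lemma acl_superset: "K \<subseteq> acl K S" "S \<subseteq> acl K S"
  unfolding acl_def
  using adjoin_superset(1)[of K S] adjoin_superset(2)[of S K] alg_cl_superset[OF is_subfield_adjoin, of K S]
  by auto

lemma acl_subset_acl:
  fixes K :: "'a::field_char_0 set"
  shows "acl K S \<subseteq> acl K T \<longleftrightarrow> S \<subseteq> acl K T"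
proof
  assume "S \<subseteq> acl K T"
  then show "acl K S \<subseteq> acl K T" by (simp add: acl_iff_ders subset_iff)
qed (use acl_superset(2) in blast)

text \<open>Sending the generators into \<open>adjoin K S\<close>, the derivation preserves this
  field, and \<open>derivation_preserves\<close> handles the elements of \<open>F\<close> algebraic
  over it.\<close>

lemma acl_closed_derivation:
  fixes D :: "'a::field_char_0 \<Rightarrow> 'a"
  assumes D: "D \<in> ders K" and S: "\<And>s. s \<in> S \<Longrightarrow> D s \<in> adjoin K S" and F: "is_subfield F" "K \<subseteq> F" "S \<subseteq> F"
    and u: "u \<in> F" "u \<in> acl K S"
  shows "D u \<in> F"
proof (rule derivation_preserves[OF dersD(1)[OF D] is_subfield_adjoin[of K S] F(1)])
  let ?A = "adjoin K S"
  note A = is_subfield_adjoin[of K S]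
  have "is_subfield {a \<in> ?A. D a \<in> ?A}"
    unfolding is_subfield_def
    using A dersD(1)[OF D] by (auto simp: derivationD derivation_inverse intro!: is_subfieldD)
  then have "?A \<subseteq> {a \<in> ?A. D a \<in> ?A}"
    using S adjoin_superset(1)[of K S] adjoin_superset(2)[of S K] dersD(2)[OF D] is_subfieldD(1)[OF A] by (intro adjoin_least) auto
  then show "D a \<in> ?A" if "a \<in> ?A" for a using that by blast
  show "?A \<subseteq> F" using F by (rule adjoin_least)
qed (use u in \<open>auto simp: acl_def\<close>)

section \<open>Derivations and algebraic independence\<close>

definition monomial :: "('a::field \<Rightarrow>\<^sub>0 nat) \<Rightarrow> 'a" where
  "monomial m = (\<Prod>v\<in>Poly_Mapping.keys m. v ^ Poly_Mapping.lookup m v)"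

text \<open>The weight \<open>w\<close> is a parameter so that one sum covers both the value of
  \<open>p\<close>, with weight \<open>monomial\<close>, and the value of its image under
  \<open>b \<partial>/\<partial>b\<close>.\<close>

definition eval_with :: "(('a::field \<Rightarrow>\<^sub>0 nat) \<Rightarrow> 'a) \<Rightarrow> (('a \<Rightarrow>\<^sub>0 nat) \<Rightarrow>\<^sub>0 'a) \<Rightarrow> 'a" where
  "eval_with w p = (\<Sum>m\<in>Poly_Mapping.keys p. Poly_Mapping.lookup p m * w m)"

lemma eval_self_eq: "eval_self p = eval_with monomial p"
  unfolding eval_self_def eval_with_def monomial_def ..

lemma monomial_superset:
  "finite S \<Longrightarrow> Poly_Mapping.keys m \<subseteq> S \<Longrightarrow> monomial m = (\<Prod>v\<in>S. v ^ Poly_Mapping.lookup m v)"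
  unfolding monomial_def by (rule prod.mono_neutral_left) (auto simp: in_keys_iff)

lemma monomial_add: "monomial (m + n) = monomial m * monomial n"
proof -
  let ?S = "Poly_Mapping.keys m \<union> Poly_Mapping.keys n"
  have "Poly_Mapping.keys (m + n) \<subseteq> ?S" by (rule Poly_Mapping.keys_add)
  then show ?thesis
    using monomial_superset[of ?S] by (simp add: lookup_add power_add prod.distrib)
qed

lemma monomial_0: "monomial 0 = 1"
  unfolding monomial_def by simp

lemma monomial_single: "monomial (Poly_Mapping.single v n) = v ^ n"
  using monomial_superset[of "{v}" "Poly_Mapping.single v n"] by (auto simp: keys_single)

lemma eval_with_superset:
  "finite S \<Longrightarrow> Poly_Mapping.keys p \<subseteq> S \<Longrightarrow> eval_with w p = (\<Sum>m\<in>S. Poly_Mapping.lookup p m * w m)"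
  unfolding eval_with_def by (rule sum.mono_neutral_left) (auto simp: in_keys_iff)

lemma eval_with_0: "eval_with w 0 = 0"
  unfolding eval_with_def by simp

lemma eval_with_add: "eval_with w (p + q) = eval_with w p + eval_with w q"
proof -
  let ?S = "Poly_Mapping.keys p \<union> Poly_Mapping.keys q"
  have "Poly_Mapping.keys (p + q) \<subseteq> ?S" by (rule Poly_Mapping.keys_add)
  then show ?thesis
    using eval_with_superset[of ?S] by (simp add: lookup_add distrib_right sum.distrib)
qed

lemma eval_with_uminus: "eval_with w (- p) = - eval_with w p"
  using eval_with_add[of w p "- p"] by (simp add: eval_with_0 eq_neg_iff_add_eq_0 add.commute)

lemma eval_with_sum: "eval_with w (sum f I) = (\<Sum>i\<in>I. eval_with w (f i))"
  by (induction I rule: infinite_finite_induct) (simp_all add: eval_with_0 eval_with_add)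

lemma eval_with_single: "eval_with w (Poly_Mapping.single m c) = c * w m"
  using eval_with_superset[of "{m}" "Poly_Mapping.single m c"] by (auto simp: keys_single)

lemma mult_eq_sum_single:
  fixes p q :: "'b::monoid_add \<Rightarrow>\<^sub>0 'a::semiring_0"
  shows "p * q = (\<Sum>m\<in>Poly_Mapping.keys p. \<Sum>n\<in>Poly_Mapping.keys q.
     Poly_Mapping.single (m + n) (Poly_Mapping.lookup p m * Poly_Mapping.lookup q n))"
proof -
  have sum_single: "(\<Sum>m\<in>Poly_Mapping.keys p. Poly_Mapping.single m (Poly_Mapping.lookup p m)) = p"
    for p :: "'b \<Rightarrow>\<^sub>0 'a"
    by (rule poly_mapping_eqI) (auto simp: lookup_sum lookup_single when_def in_keys_iff)
  have "p * q = (\<Sum>m\<in>Poly_Mapping.keys p. Poly_Mapping.single m (Poly_Mapping.lookup p m)) *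
      (\<Sum>n\<in>Poly_Mapping.keys q. Poly_Mapping.single n (Poly_Mapping.lookup q n))"
    by (simp add: sum_single)
  then show ?thesis by (simp add: sum_product mult_single)
qed

lemma eval_with_mult:
  "eval_with w (p * q) = (\<Sum>m\<in>Poly_Mapping.keys p. \<Sum>n\<in>Poly_Mapping.keys q.
     Poly_Mapping.lookup p m * Poly_Mapping.lookup q n * w (m + n))"
  by (subst mult_eq_sum_single) (simp add: eval_with_sum eval_with_single)

definition poly_over :: "'a::field set \<Rightarrow> 'a set \<Rightarrow> (('a \<Rightarrow>\<^sub>0 nat) \<Rightarrow>\<^sub>0 'a) set" where
  "poly_over K B =
     {p. \<forall>m\<in>Poly_Mapping.keys p. Poly_Mapping.keys m \<subseteq> B \<and> Poly_Mapping.lookup p m \<in> K}"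

lemma poly_over_closed:
  assumes K: "is_subfield K"
  shows "0 \<in> poly_over K B"
    and "p \<in> poly_over K B \<Longrightarrow> q \<in> poly_over K B \<Longrightarrow> p + q \<in> poly_over K B"
    and "p \<in> poly_over K B \<Longrightarrow> - p \<in> poly_over K B"
    and "Poly_Mapping.keys m \<subseteq> B \<Longrightarrow> c \<in> K \<Longrightarrow> Poly_Mapping.single m c \<in> poly_over K B"
    and "p \<in> poly_over K B \<Longrightarrow> q \<in> poly_over K B \<Longrightarrow> p * q \<in> poly_over K B"
proof -
  show 0: "0 \<in> poly_over K B" unfolding poly_over_def by simp
  have coeff: "Poly_Mapping.lookup p m \<in> K" if "p \<in> poly_over K B" for p m
    using that is_subfieldD(1)[OF K] unfolding poly_over_def
    by (cases "m \<in> Poly_Mapping.keys p") (auto simp: in_keys_iff)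
  show add: "p + q \<in> poly_over K B" if "p \<in> poly_over K B" "q \<in> poly_over K B" for p q
    using that Poly_Mapping.keys_add[of p q] coeff[OF that(1)] coeff[OF that(2)] is_subfieldD(3)[OF K]
    unfolding poly_over_def by (auto simp: lookup_add)
  show "p \<in> poly_over K B \<Longrightarrow> - p \<in> poly_over K B"
    using is_subfieldD(5)[OF K] unfolding poly_over_def by auto
  show single: "Poly_Mapping.single m c \<in> poly_over K B" if "Poly_Mapping.keys m \<subseteq> B" "c \<in> K" for m c
    using that unfolding poly_over_def by (auto simp: keys_single split: if_splits)
  have sum: "sum f I \<in> poly_over K B" if "\<And>i. i \<in> I \<Longrightarrow> f i \<in> poly_over K B"
    for I and f :: "('a \<Rightarrow>\<^sub>0 nat) \<Rightarrow> (('a \<Rightarrow>\<^sub>0 nat) \<Rightarrow>\<^sub>0 'a)"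
    using that by (induction I rule: infinite_finite_induct) (auto intro: 0 add)
  show "p * q \<in> poly_over K B" if pq: "p \<in> poly_over K B" "q \<in> poly_over K B"
  proof (subst mult_eq_sum_single, intro sum single)
    fix m n assume "m \<in> Poly_Mapping.keys p" "n \<in> Poly_Mapping.keys q"
    then show "Poly_Mapping.keys (m + n) \<subseteq> B"
      using pq Poly_Mapping.keys_add[of m n] unfolding poly_over_def by blast
    show "Poly_Mapping.lookup p m * Poly_Mapping.lookup q n \<in> K"
      using coeff pq is_subfieldD(4)[OF K] by blast
  qed
qed

text \<open>
  The derivation \<open>b \<partial>/\<partial>b\<close> multiplies a monomial by its exponent at \<open>b\<close>; it is well-defined on
  \<open>K[B]\<close> because the elements of \<open>B\<close> satisfy no relation.
\<close>

lemma alg_indep_imp_not_acl: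
  fixes K :: "'a::field_char_0 set"
  assumes K: "is_subfield K" and ind: "alg_indep K B" and b: "b \<in> B"
  shows "b \<notin> acl K (B - {b})"
proof -
  define e where "e m = of_nat (Poly_Mapping.lookup m b) * monomial m" for m :: "'a \<Rightarrow>\<^sub>0 nat"
  define G where "G = (\<lambda>p. (eval_with monomial p, eval_with e p)) ` poly_over K B"
  note closed = poly_over_closed[OF K]
  have inj: "p = 0" if "p \<in> poly_over K B" "eval_with monomial p = 0" for p
    using ind that unfolding alg_indep_def poly_over_def eval_self_eq by blast
  have single: "(c * monomial m, c * e m) \<in> G" if "c \<in> K" "Poly_Mapping.keys m \<subseteq> B" for c m
    using imageI[OF poly_over_closed(4)[OF K that(2,1)], of "\<lambda>p. (eval_with monomial p, eval_with e p)"]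
    by (simp add: G_def eval_with_single)
  have const: "(c, 0) \<in> G" if "c \<in> K" for c
    using single[OF that, of 0] by (simp add: monomial_0 e_def)
  have "derivation_graph G"
    unfolding derivation_graph_def
  proof (intro conjI allI impI)
    show "(1, 0) \<in> G" using const is_subfieldD(2)[OF K] by blast
  next
    fix a' assume "(0, a') \<in> G"
    then obtain p where p: "p \<in> poly_over K B" "eval_with monomial p = 0" "a' = eval_with e p"
      unfolding G_def by auto
    with inj[OF p(1,2)] show "a' = 0" by (simp add: eval_with_0)
  next
    fix a a' assume "(a, a') \<in> G"
    then obtain p where "p \<in> poly_over K B" "a = eval_with monomial p" "a' = eval_with e p"
      unfolding G_def by blast
    then show "(- a, - a') \<in> G"
      unfolding G_def by (auto simp: eval_with_uminus intro!: image_eqI[of _ _ "- p"] closed)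
  next
    fix a a' c c' assume "(a, a') \<in> G" "(c, c') \<in> G"
    then obtain p q where pq: "p \<in> poly_over K B" "a = eval_with monomial p" "a' = eval_with e p"
      "q \<in> poly_over K B" "c = eval_with monomial q" "c' = eval_with e q"
      unfolding G_def by blast
    show "(a + c, a' + c') \<in> G"
      unfolding G_def using pq by (auto simp: eval_with_add intro!: image_eqI[of _ _ "p + q"] closed)
    have "a * c = eval_with monomial (p * q)"
      unfolding pq eval_with_mult monomial_add unfolding eval_with_def sum_product by (simp add: algebra_simps)
    moreover have "a * c' + a' * c = eval_with e (p * q)"
      unfolding pq eval_with_mult e_def monomial_add lookup_add
      unfolding eval_with_def sum_product sum.distrib[symmetric] by (simp add: algebra_simps)
    ultimately show "(a * c, a * c' + a' * c) \<in> G"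
      unfolding G_def using pq by (auto intro!: image_eqI[of _ _ "p * q"] closed)
  qed
  then obtain D where D: "derivation D" "\<And>u v. (u, v) \<in> G \<Longrightarrow> D u = v"
    by (rule derivation_extension) (rule that)
  have "D \<in> ders K"
    using D const unfolding ders_def by auto
  moreover have "D v = (if v = b then b else 0)" if "v \<in> B" for v
    using D(2) single[of 1 "Poly_Mapping.single v 1"] that is_subfieldD(2)[OF K]
    by (auto simp: monomial_single e_def lookup_single)
  \<comment> \<open>As \<open>D\<close> sends \<open>b\<close> to \<open>b\<close>, it detects
    \<open>b\<close> only if \<open>b\<close> is nonzero; otherwise the variable \<open>b\<close>
    alone would be a relation.\<close>
  moreover have "b \<noteq> 0"
  proof
    assume "b = 0"
    let ?p = "Poly_Mapping.single (Poly_Mapping.single b (1::nat)) (1::'a)"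
    have "?p = 0"
      using b is_subfieldD(2)[OF K] \<open>b = 0\<close>
      by (intro inj closed) (auto simp: eval_with_single monomial_single)
    then show False by (metis lookup_single_eq lookup_zero zero_neq_one)
  qed
  ultimately show ?thesis
    using b by (auto simp: acl_iff_ders intro!: bexI[of _ D] split: if_splits)
qed

text \<open>Only the power of \<open>b\<close> contributes, the other factors being constants.
  Multiplying by \<open>b\<close> avoids the exponent \<open>n - 1\<close>.\<close>

lemma euler_derivation_monomial:
  fixes D :: "'a::field_char_0 \<Rightarrow> 'a"
  assumes D: "derivation D" and m: "\<And>v. v \<in> Poly_Mapping.keys m - {b} \<Longrightarrow> D v = 0"
  shows "b * D (monomial m) = of_nat (Poly_Mapping.lookup m b) * monomial m * D b"
proof -
  have pow: "b * D (b ^ n) = of_nat n * b ^ n * D b" for n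
    by (induction n) (simp_all add: derivationD[OF D] algebra_simps)
  let ?S = "insert b (Poly_Mapping.keys m)"
  define r where "r = (\<Prod>v\<in>Poly_Mapping.keys m - {b}. v ^ Poly_Mapping.lookup m v)"
  have eq: "monomial m = b ^ Poly_Mapping.lookup m b * r"
    unfolding r_def using monomial_superset[of ?S m] by (simp add: prod.insert_remove subset_insertI)
  have zero: "D (prod f I) = 0" if "\<And>i. i \<in> I \<Longrightarrow> D (f i) = 0" for I and f :: "'a \<Rightarrow> 'a"
    using that by (induction I rule: infinite_finite_induct) (auto simp: derivationD[OF D])
  have zero_pow: "D (v ^ n) = 0" if "D v = 0" for v n
    using that by (induction n) (auto simp: derivationD[OF D])
  have "D r = 0"
    unfolding r_def by (intro zero zero_pow m)
  then have "b * D (monomial m) = b * D (b ^ Poly_Mapping.lookup m b) * r"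
    unfolding eq by (simp add: derivationD[OF D])
  then show ?thesis
    unfolding pow eq by (simp add: algebra_simps)
qed

text \<open>
  This is the independence of characters: the derivations \<open>b \<partial>/\<partial>b\<close> have the monomials as common
  eigenvectors, with distinct systems of eigenvalues.
\<close>

lemma not_acl_imp_alg_indep:
  fixes K :: "'a::field_char_0 set"
  assumes K: "is_subfield K" and B: "\<And>b. b \<in> B \<Longrightarrow> b \<notin> acl K (B - {b})"
  shows "alg_indep K B"
proof -
  have nz: "b \<noteq> 0" if "b \<in> B" for b
    using B[OF that] is_subfieldD(1)[OF is_subfield_acl] by metis
  \<comment> \<open>The coefficients \<open>c\<close> stay general because the induction multiplies
    them by differences of eigenvalues.\<close>
  have indep: "\<forall>m\<in>M. c m = 0"
    if "finite M" "\<And>m. m \<in> M \<Longrightarrow> Poly_Mapping.keys m \<subseteq> B" "\<And>m. m \<in> M \<Longrightarrow> c m \<in> K"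
      "(\<Sum>m\<in>M. c m * monomial m) = 0" for M c
    using that
  proof (induction M arbitrary: c rule: finite_induct)
    case (insert m0 M)
    have "c m = 0" if m: "m \<in> M" for m
    proof -
      from m insert.hyps have "m \<noteq> m0" by blast
      then obtain b where b: "Poly_Mapping.lookup m b \<noteq> Poly_Mapping.lookup m0 b"
        by (metis poly_mapping_eqI)
      then have "b \<in> Poly_Mapping.keys m \<union> Poly_Mapping.keys m0"
        by (auto simp: in_keys_iff)
      with insert.prems(1) m have bB: "b \<in> B" by blast
      then obtain D where D: "D \<in> ders K" "\<And>v. v \<in> B - {b} \<Longrightarrow> D v = 0" "D b \<noteq> 0"
        using B unfolding acl_iff_ders by blast
      note D' = dersD(1)[OF D(1)]
      let ?l = "\<lambda>m. of_nat (Poly_Mapping.lookup m b) :: 'a"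
      have "b * D (c n * monomial n) = D b * (c n * ?l n * monomial n)" if "n \<in> insert m0 M" for n
        using euler_derivation_monomial[OF D', of n b] insert.prems(1,2)[OF that] D(2) dersD(2)[OF D(1)]
        by (auto simp: derivationD[OF D'] algebra_simps subset_iff)
      then have "b * D (\<Sum>n\<in>insert m0 M. c n * monomial n) = D b * (\<Sum>n\<in>insert m0 M. c n * ?l n * monomial n)"
        unfolding derivation_sum[OF D'] sum_distrib_left by (rule sum.cong[OF refl])
      then have 1: "(\<Sum>n\<in>insert m0 M. c n * ?l n * monomial n) = 0"
        using insert.prems(3) D(3) derivationD(3)[OF D'] by simp
      \<comment> \<open>Subtracting \<open>?l m0\<close> times the relation from the differentiated
        one cancels the term of \<open>m0\<close>; at \<open>m\<close> the factor is nonzero by the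
        choice of \<open>b\<close>.\<close>
      have "(\<Sum>n\<in>M. c n * (?l n - ?l m0) * monomial n)
          = (\<Sum>n\<in>insert m0 M. c n * (?l n - ?l m0) * monomial n)"
        using insert.hyps by simp
      also have "\<dots> = (\<Sum>n\<in>insert m0 M. c n * ?l n * monomial n) - ?l m0 * (\<Sum>n\<in>insert m0 M. c n * monomial n)"
        unfolding sum_distrib_left sum_subtractf[symmetric] by (rule sum.cong) (simp_all add: algebra_simps)
      also have "\<dots> = 0" using 1 insert.prems(3) by simp
      finally have "\<forall>n\<in>M. c n * (?l n - ?l m0) = 0"
        using insert.prems(1,2)
        by (intro insert.IH) (auto intro!: is_subfieldD(4,7)[OF K] is_subfield_of_nat[OF K])
      with m b show "c m = 0" by auto
    qed
    moreover from this have "c m0 * monomial m0 = 0"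
      using insert.prems(3) insert.hyps by simp
    moreover have "monomial m0 \<noteq> 0"
      using insert.prems(1)[of m0] nz unfolding monomial_def by auto
    ultimately show ?case by auto
  qed simp
  show ?thesis
    unfolding alg_indep_def eval_self_eq
  proof (intro allI impI)
    fix p :: "('a \<Rightarrow>\<^sub>0 nat) \<Rightarrow>\<^sub>0 'a"
    assume p: "\<forall>m\<in>Poly_Mapping.keys p. Poly_Mapping.keys m \<subseteq> B \<and> Poly_Mapping.lookup p m \<in> K"
      and 0: "eval_with monomial p = 0"
    then have "\<forall>m\<in>Poly_Mapping.keys p. Poly_Mapping.lookup p m = 0"
      by (intro indep) (auto simp: eval_with_def)
    then show "p = 0"
      by (metis all_not_in_conv in_keys_iff keys_eq_empty)
  qed
qed

lemma alg_indep_iff: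
  fixes K :: "'a::field_char_0 set"
  assumes "is_subfield K"
  shows "alg_indep K B \<longleftrightarrow> (\<forall>b\<in>B. b \<notin> acl K (B - {b}))"
  using alg_indep_imp_not_acl[OF assms] not_acl_imp_alg_indep[OF assms] by blast

section \<open>Coordinates on the differentials\<close>

text \<open>Some linear map fixes \<open>u\<close> and kills \<open>T\<close>; its matrix row at a
  nonzero coordinate of \<open>u\<close> is the functional.\<close>

lemma separating_functional:
  fixes u :: "'a::field ^ 'n"
  assumes "u \<notin> vec.span T"
  obtains c :: "'a ^ 'n" where "\<And>t. t \<in> T \<Longrightarrow> (\<Sum>i\<in>UNIV. c $ i * t $ i) = 0" "(\<Sum>i\<in>UNIV. c $ i * u $ i) \<noteq> 0"
proof -
  obtain B where B: "B \<subseteq> T" "vec.independent B" "T \<subseteq> vec.span B"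
    using vec.basis_exists[of T] by metis
  have "u \<notin> vec.span B"
    using assms vec.span_mono[OF B(1)] by blast
  then have ind: "vec.independent (insert u B)"
    using B(2) vec.independent_insertI by blast
  obtain g :: "'a ^ 'n \<Rightarrow> 'a ^ 'n" where g: "Vector_Spaces.linear (*s) (*s) g"
      "\<forall>v\<in>insert u B. g v = (if v = u then u else 0)"
    using vec.linear_independent_extend[OF ind, of "\<lambda>v. if v = u then u else 0"] by blast
  have gB: "B \<subseteq> {v. g v = 0}"
    using g(2) vec.span_base[of _ B] \<open>u \<notin> vec.span B\<close> by auto
  have "vec.subspace {v. g v = 0}"
    using g(1) by (rule vec.linear_subspace_kernel)
  then have "vec.span B \<subseteq> {v. g v = 0}"
    by (rule vec.span_minimal[OF gB])
  with B(3) have gT: "g t = 0" if "t \<in> T" for t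
    using that by blast
  have "u \<noteq> 0" using assms vec.span_zero by metis
  then obtain j where j: "u $ j \<noteq> 0" by (auto simp: vec_eq_iff)
  have row: "g v $ j = (\<Sum>i\<in>UNIV. matrix g $ j $ i * v $ i)" for v
    by (subst matrix_works[OF g(1), symmetric]) (simp add: matrix_vector_mult_def)
  show ?thesis
  proof (rule that[of "matrix g $ j"])
    show "(\<Sum>i\<in>UNIV. matrix g $ j $ i * t $ i) = 0" if "t \<in> T" for t
      using gT[OF that] row[of t] by simp
    show "(\<Sum>i\<in>UNIV. matrix g $ j $ i * u $ i) \<noteq> 0"
      using j row[of u] g(2) by simp
  qed
qed

lemma functional_subspace: "vec.subspace {v :: 'a::field ^ 'n. (\<Sum>i\<in>UNIV. c i * v $ i) = 0}"
  unfolding vec.subspace_def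
  by (auto simp: algebra_simps sum.distrib sum_distrib_left[symmetric])

lemma in_span_pair:
  fixes u v w :: "'a::field ^ 'n"
  shows "u \<in> vec.span {v, w} \<longleftrightarrow> (\<exists>s t. u = s *s v + t *s w)"
  by (simp add: vec.span_breakdown_eq diff_diff_eq)

lemma dim_pair:
  fixes v w :: "'a::field ^ 'n"
  assumes "v \<noteq> 0" "\<And>t. w \<noteq> t *s v"
  shows "vec.dim {v, w} = 2"
proof -
  have "w \<notin> vec.span {v}" using assms(2) by (auto simp: vec.span_singleton)
  moreover have "w \<noteq> v" using assms(2)[of 1] by auto
  ultimately show ?thesis
    using assms(1) vec.dim_eq_card_independent[of "{v, w}"]
      vec.independent_insertI[of w "{v}"] by (auto simp: insert_commute)
qed

lemma dim_2_obtain: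
  fixes W :: "('a::field ^ 'n) set"
  assumes "vec.dim W = 2"
  obtains v w where "v \<in> W" "w \<in> W" "v \<noteq> 0" "\<And>t. w \<noteq> t *s v" "vec.span W = vec.span {v, w}"
proof -
  obtain B where B: "B \<subseteq> W" "vec.independent B" "W \<subseteq> vec.span B" "card B = 2"
    using vec.basis_exists[of W] assms by metis
  then obtain v w where vw: "B = {v, w}" "v \<noteq> w" by (auto simp: card_2_iff)
  have "v \<noteq> 0" using B(2) vw vec.dependent_zero by blast
  moreover have "w \<noteq> t *s v" for t
    using B(2) vw unfolding vec.dependent_def vec.span_singleton
    by (auto simp: insert_Diff_if vec.span_singleton)
  moreover have "vec.span W = vec.span B"
    using B(1,3) by (simp add: vec.span_mono vec.span_minimal subset_antisym)
  ultimately show ?thesis using B(1) vw by (intro that[of v w]) auto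
qed

section \<open>Dual derivations and the vector matroid of differentials\<close>

lemma ders_minus_lincomb:
  "E \<in> ders K \<Longrightarrow> (\<And>i. i \<in> I \<Longrightarrow> D i \<in> ders K) \<Longrightarrow> (\<lambda>w. E w - (\<Sum>i\<in>I. c i * D i w)) \<in> ders K"
  using ders_lincomb[of I D K c] unfolding ders_def derivation_def by (auto simp: algebra_simps)

text \<open>The \<open>D i\<close> are partial derivatives with respect to the elements
  \<open>b i\<close>, but defined on the whole ambient field.\<close>

locale frame =
  fixes K :: "'a::field_char_0 set" and b :: "'n::finite \<Rightarrow> 'a" and D :: "'n \<Rightarrow> 'a \<Rightarrow> 'a"
  assumes K: "is_subfield K"
    and D: "\<And>i. D i \<in> ders K"
    and dual: "\<And>i j. D i (b j) = (if i = j then 1 else 0)"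
begin

definition d :: "'a \<Rightarrow> 'a ^ 'n" where "d w = (\<chi> i. D i w)"

definition M :: "'a set" where "M = acl K (range b)"

lemma d_nth: "d w $ i = D i w"
  unfolding d_def by simp

lemma subfield_M: "is_subfield M"
  unfolding M_def by (rule is_subfield_acl)

lemma b_in_M: "b i \<in> M"
  unfolding M_def using acl_superset(2)[of "range b" K] by auto

lemma acl_subset_M: "S \<subseteq> M \<Longrightarrow> acl K S \<subseteq> M"
  unfolding M_def acl_subset_acl .

lemma alg_cl_subset_M: "alg_cl K \<subseteq> M"
  unfolding alg_cl_eq_acl[OF K] by (rule acl_subset_M) simp

text \<open>The difference of both sides is a derivation over \<open>K\<close> vanishing at all
  \<open>b i\<close>, hence on \<open>M\<close>. So \<open>E\<close> acts on \<open>M\<close> as a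
  linear functional of the differential.\<close>

lemma ders_expand:
  assumes E: "E \<in> ders K" and w: "w \<in> M"
  shows "E w = (\<Sum>i\<in>UNIV. E (b i) * d w $ i)"
proof -
  have "(\<lambda>w. E w - (\<Sum>i\<in>UNIV. E (b i) * D i w)) \<in> ders K"
    using E D by (intro ders_minus_lincomb)
  then have "E w - (\<Sum>i\<in>UNIV. E (b i) * D i w) = 0"
    using w unfolding M_def acl_iff_ders by (auto simp: dual if_distrib[of "(*) _"] cong: if_cong)
  then show ?thesis by (simp add: d_nth)
qed

text \<open>On \<open>M\<close> the closure operator is that of the vector matroid of the differentials.\<close>

lemma acl_iff_span:
  assumes S: "S \<subseteq> M" and w: "w \<in> M"
  shows "w \<in> acl K S \<longleftrightarrow> d w \<in> vec.span (d ` S)"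
proof
  assume w': "w \<in> acl K S"
  show "d w \<in> vec.span (d ` S)"
  proof (rule ccontr)
    assume "d w \<notin> vec.span (d ` S)"
    then obtain c where c: "\<And>t. t \<in> d ` S \<Longrightarrow> (\<Sum>i\<in>UNIV. c $ i * t $ i) = 0"
      "(\<Sum>i\<in>UNIV. c $ i * d w $ i) \<noteq> 0"
      by (rule separating_functional) (rule that)
    \<comment> \<open>The separating functional becomes a derivation that kills \<open>S\<close> but
      not \<open>w\<close>.\<close>
    have "(\<lambda>w. \<Sum>i\<in>UNIV. c $ i * D i w) \<in> ders K"
      using D by (rule ders_lincomb)
    moreover have "(\<Sum>i\<in>UNIV. c $ i * D i s) = 0" if "s \<in> S" for s
      using c(1)[OF imageI[OF that]] by (simp add: d_nth)
    ultimately have "(\<Sum>i\<in>UNIV. c $ i * D i w) = 0"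
      using bspec[OF w'[unfolded acl_iff_ders]] by auto
    with c(2) show False by (simp add: d_nth)
  qed
next
  assume *: "d w \<in> vec.span (d ` S)"
  show "w \<in> acl K S"
    unfolding acl_iff_ders
  proof (intro ballI impI)
    fix E assume E: "E \<in> ders K" "\<forall>s\<in>S. E s = 0"
    have "d ` S \<subseteq> {v. (\<Sum>i\<in>UNIV. E (b i) * v $ i) = 0}"
      using E S ders_expand by auto
    then have "vec.span (d ` S) \<subseteq> {v. (\<Sum>i\<in>UNIV. E (b i) * v $ i) = 0}"
      using functional_subspace by (rule vec.span_minimal)
    with * show "E w = 0"
      unfolding ders_expand[OF E(1) w] by blast
  qed
qed

lemma d_eq_0_iff: "w \<in> M \<Longrightarrow> d w = 0 \<longleftrightarrow> w \<in> alg_cl K"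
  using acl_iff_span[of "{}" w] by (simp add: alg_cl_eq_acl[OF K])

text \<open>Injectivity is part of the condition because the set of differentials cannot record that
  two elements of \<open>B\<close> share one.\<close>

lemma alg_indep_iff_independent:
  assumes "B \<subseteq> M"
  shows "alg_indep K B \<longleftrightarrow> inj_on d B \<and> vec.independent (d ` B)"
proof -
  have "alg_indep K B \<longleftrightarrow> (\<forall>v\<in>B. d v \<notin> vec.span (d ` (B - {v})))"
    unfolding alg_indep_iff[OF K]
  proof (intro ball_cong refl arg_cong[of _ _ Not])
    show "v \<in> acl K (B - {v}) \<longleftrightarrow> d v \<in> vec.span (d ` (B - {v}))" if "v \<in> B" for v
      using assms that by (intro acl_iff_span) auto
  qed
  also have "\<dots> \<longleftrightarrow> inj_on d B \<and> vec.independent (d ` B)"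
  proof
    assume *: "\<forall>v\<in>B. d v \<notin> vec.span (d ` (B - {v}))"
    have inj: "inj_on d B"
    proof (rule inj_onI, rule ccontr)
      fix v w assume "v \<in> B" "w \<in> B" "d v = d w" "v \<noteq> w"
      then have "d v \<in> d ` (B - {v})" by auto
      then have "d v \<in> vec.span (d ` (B - {v}))" by (rule vec.span_base)
      with * \<open>v \<in> B\<close> show False by blast
    qed
    then have "d ` (B - {v}) = d ` B - {d v}" if "v \<in> B" for v
      using that by (auto simp: inj_on_def)
    with * inj show "inj_on d B \<and> vec.independent (d ` B)"
      unfolding vec.dependent_def by auto
  next
    assume *: "inj_on d B \<and> vec.independent (d ` B)"
    then have "d ` (B - {v}) = d ` B - {d v}" if "v \<in> B" for v
      using that by (auto simp: inj_on_def)
    with * show "\<forall>v\<in>B. d v \<notin> vec.span (d ` (B - {v}))"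
      unfolding vec.dependent_def by auto
  qed
  finally show ?thesis .
qed

lemma finite_basis:
  obtains U where "U \<subseteq> T" "finite U" "inj_on d U" "vec.independent (d ` U)"
    "d ` T \<subseteq> vec.span (d ` U)" "card U = vec.dim (d ` T)"
proof -
  obtain B where B: "B \<subseteq> d ` T" "vec.independent B" "d ` T \<subseteq> vec.span B" "card B = vec.dim (d ` T)"
    using vec.basis_exists[of "d ` T"] by metis
  then obtain U where U: "U \<subseteq> T" "inj_on d U" "B = d ` U"
    by (auto simp: subset_image_inj)
  moreover have "finite U"
    using vec.finiteI_independent[OF B(2)] U finite_imageD by blast
  ultimately show ?thesis
    using B card_image[OF U(2)] by (intro that[of U]) auto
qed

text \<open>Differentials of an independent set are independent vectors in the span of those of
  \<open>T\<close>, which bounds its size; a basis of this span lifted to \<open>T\<close> attains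
  the bound.\<close>

lemma tr_deg_acl:
  assumes T: "T \<subseteq> M"
  shows "tr_deg K (acl K T) = enat (vec.dim (d ` T))"
  unfolding tr_deg_def
proof (rule antisym)
  show "(SUP B\<in>{B. B \<subseteq> acl K T \<and> finite B \<and> alg_indep K B}. enat (card B)) \<le> enat (vec.dim (d ` T))"
  proof (rule SUP_least, clarify)
    fix B assume B: "B \<subseteq> acl K T" "finite B" "alg_indep K B"
    have "B \<subseteq> M" using B(1) acl_subset_M[OF T] by blast
    then have ind: "inj_on d B" "vec.independent (d ` B)"
      using B(3) alg_indep_iff_independent by auto
    have "d ` B \<subseteq> vec.span (d ` T)"
    proof clarify
      fix v assume "v \<in> B"
      with B(1) \<open>B \<subseteq> M\<close> show "d v \<in> vec.span (d ` T)"
        by (subst acl_iff_span[OF T, symmetric]) auto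
    qed
    then have "card (d ` B) \<le> vec.dim (vec.span (d ` T))"
      using ind(2) by (intro vec.independent_card_le_dim) 
    then show "enat (card B) \<le> enat (vec.dim (d ` T))"
      by (simp add: card_image[OF ind(1)] vec.dim_span)
  qed
next
  obtain U where U: "U \<subseteq> T" "finite U" "inj_on d U" "vec.independent (d ` U)" "card U = vec.dim (d ` T)"
    by (rule finite_basis[of T]) (rule that)
  have "alg_indep K U"
    using U T alg_indep_iff_independent[of U] by blast
  moreover have "U \<subseteq> acl K T" using U(1) acl_superset(2)[of T K] by blast
  ultimately show "enat (vec.dim (d ` T)) \<le> (SUP B\<in>{B. B \<subseteq> acl K T \<and> finite B \<and> alg_indep K B}. enat (card B))"
    using U by (intro SUP_upper2[of U]) auto
qed

end

section \<open>Points and lines\<close>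

context frame
begin

definition V :: "'a set set \<Rightarrow> ('a ^ 'n) set" where "V Y = vec.span (d ` \<Union>Y)"

text \<open>Directions are homogeneous coordinates: the factor \<open>t\<close> may be any nonzero
  element of the ambient field, so no generator is preferred.\<close>

definition dir :: "'a set \<Rightarrow> 'a ^ 'n \<Rightarrow> bool" where
  "dir p v \<longleftrightarrow> (\<exists>l\<in>M. p = acl K {l} \<and> v \<noteq> 0 \<and> (\<exists>t. t \<noteq> 0 \<and> d l = t *s v))"

lemma dirI: "w \<in> M \<Longrightarrow> d w \<noteq> 0 \<Longrightarrow> dir (acl K {w}) (d w)"
  unfolding dir_def by (intro bexI[of _ w] conjI exI[of _ 1]) auto

lemma dir_nz: "dir p v \<Longrightarrow> v \<noteq> 0"
  unfolding dir_def by blast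

lemma dir_scale:
  assumes "dir p v" "s \<noteq> 0"
  shows "dir p (s *s v)"
proof -
  obtain l t where l: "l \<in> M" "p = acl K {l}" "v \<noteq> 0" "t \<noteq> 0" "d l = t *s v"
    using assms(1) unfolding dir_def by blast
  with assms(2) show ?thesis
    unfolding dir_def by (intro bexI[of _ l] conjI exI[of _ "t / s"]) auto
qed

lemma dir_subset_M: "dir p v \<Longrightarrow> p \<subseteq> M"
  unfolding dir_def using acl_subset_M by auto

lemma span_image_acl:
  assumes "S \<subseteq> M"
  shows "vec.span (d ` acl K S) = vec.span (d ` S)"
proof
  have "d ` acl K S \<subseteq> vec.span (d ` S)"
  proof clarify
    fix w assume w: "w \<in> acl K S"
    then have "w \<in> M" using acl_subset_M[OF assms] by blast
    with w show "d w \<in> vec.span (d ` S)" using acl_iff_span[OF assms] by simp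
  qed
  then show "vec.span (d ` acl K S) \<subseteq> vec.span (d ` S)"
    by (intro vec.span_minimal) auto
  show "vec.span (d ` S) \<subseteq> vec.span (d ` acl K S)"
    by (intro vec.span_mono image_mono acl_superset)
qed

lemma span_singleton_scale: "t \<noteq> 0 \<Longrightarrow> vec.span {t *s v} = vec.span {v :: 'b::field ^ 'm}"
proof
  show "vec.span {t *s v} \<subseteq> vec.span {v}"
    by (intro vec.span_minimal) (auto intro: vec.span_scale vec.span_base)
  assume "t \<noteq> 0"
  then have "v = inverse t *s (t *s v)" by simp
  then have "v \<in> vec.span {t *s v}"
    by (metis vec.span_scale vec.span_base insertI1)
  then show "vec.span {v} \<subseteq> vec.span {t *s v}"
    by (intro vec.span_minimal) auto
qed

lemma dir_span: "dir p v \<Longrightarrow> vec.span (d ` p) = vec.span {v}"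
  unfolding dir_def by (auto simp: span_image_acl span_singleton_scale)

lemma dir_subset_iff: "dir p v \<Longrightarrow> vec.subspace W \<Longrightarrow> d ` p \<subseteq> W \<longleftrightarrow> v \<in> W"
  using dir_span[of p v] vec.span_base[of v "{v}"] vec.span_superset[of "d ` p"]
    vec.span_minimal[of "d ` p" W] vec.span_minimal[of "{v}" W] by blast

text \<open>For proportional directions the differentials of the generators span the same line, so
  each generator is algebraic over the other.\<close>

lemma dir_eq:
  assumes "dir p v" "dir q w"
  shows "p = q \<longleftrightarrow> (\<exists>t. w = t *s v)"
proof
  assume "p = q"
  then have "vec.span {v} = vec.span {w}"
    using dir_span[OF assms(1)] dir_span[OF assms(2)] by simp
  then have "w \<in> vec.span {v}"
    using vec.span_base[of w "{w}"] by simp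
  then show "\<exists>t. w = t *s v" by (auto simp: vec.span_singleton)
next
  assume "\<exists>t. w = t *s v"
  then obtain t where t: "w = t *s v" ..
  with dir_nz[OF assms(2)] have "t \<noteq> 0" by auto
  obtain l s where l: "l \<in> M" "p = acl K {l}" "s \<noteq> 0" "d l = s *s v"
    using assms(1) unfolding dir_def by blast
  obtain l' s' where l': "l' \<in> M" "q = acl K {l'}" "s' \<noteq> 0" "d l' = s' *s w"
    using assms(2) unfolding dir_def by blast
  have "vec.span {d l} = vec.span {d l'}"
    using l l' t \<open>t \<noteq> 0\<close> by (simp add: span_singleton_scale)
  then have "d l \<in> vec.span {d l'}" "d l' \<in> vec.span {d l}"
    using vec.span_base[of "d l" "{d l}"] vec.span_base[of "d l'" "{d l'}"] by simp_all
  then have "l \<in> acl K {l'}" "l' \<in> acl K {l}"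
    using l(1) l'(1) acl_iff_span[of "{l'}" l] acl_iff_span[of "{l}" l'] by auto
  then show "p = q"
    using l l' acl_subset_acl[of K "{l}" "{l'}"] acl_subset_acl[of K "{l'}" "{l}"] by auto
qed

lemma dir_mult: "dir p v \<Longrightarrow> dir p w \<Longrightarrow> \<exists>t. t \<noteq> 0 \<and> w = t *s v"
  using dir_eq[of p v p w] dir_nz[of p w] by auto

lemma geom_dir:
  assumes "p \<in> geom K L" "p \<subseteq> M"
  obtains v l where "dir p v" "l \<in> L" "p = acl K {l}" "d l = v"
proof -
  obtain l where l: "p = acl K {l}" "l \<in> L" "l \<notin> alg_cl K"
    using assms(1) unfolding geom_def by blast
  then have "l \<in> M" using assms(2) acl_superset(2)[of "{l}" K] by auto
  with l have "d l \<noteq> 0" using d_eq_0_iff by simp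
  with l \<open>l \<in> M\<close> show ?thesis using dirI by (intro that[of "d l" l]) auto
qed

lemma V_subspace: "vec.subspace (V Y)"
  unfolding V_def by simp

lemma V_minimal: "vec.subspace W \<Longrightarrow> (\<And>p. p \<in> Y \<Longrightarrow> d ` p \<subseteq> W) \<Longrightarrow> V Y \<subseteq> W"
  unfolding V_def by (intro vec.span_minimal) auto

lemma V_superset: "p \<in> Y \<Longrightarrow> d ` p \<subseteq> V Y"
  unfolding V_def using vec.span_superset[of "d ` \<Union>Y"] by auto

lemma V_mono: "Y \<subseteq> Z \<Longrightarrow> V Y \<subseteq> V Z"
  by (intro V_minimal V_subspace V_superset) auto

lemma dir_in_V: "dir p v \<Longrightarrow> p \<in> Y \<Longrightarrow> v \<in> V Y"
  using dir_subset_iff[OF _ V_subspace, of p v Y] V_superset[of p Y] by simp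

lemma V_pair: 
  assumes "dir p v" "dir q w"
  shows "V {p, q} = vec.span {v, w}"
proof
  have "d ` p \<subseteq> vec.span {v, w}" "d ` q \<subseteq> vec.span {v, w}"
    using assms by (simp_all add: dir_subset_iff vec.span_base)
  then show "V {p, q} \<subseteq> vec.span {v, w}"
    by (intro V_minimal) auto
  show "vec.span {v, w} \<subseteq> V {p, q}"
    using assms by (intro vec.span_minimal V_subspace) (auto intro: dir_in_V)
qed

lemma geom_rank_eq: "\<Union>Y \<subseteq> M \<Longrightarrow> geom_rank K Y = enat (vec.dim (V Y))"
  unfolding geom_rank_def V_def by (simp add: tr_deg_acl vec.dim_span)

lemma subset_acl_iff:
  assumes "p \<subseteq> M" "\<Union>Y \<subseteq> M"
  shows "p \<subseteq> acl K (\<Union>Y) \<longleftrightarrow> d ` p \<subseteq> V Y"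
proof -
  have "w \<in> acl K (\<Union>Y) \<longleftrightarrow> d w \<in> V Y" if "w \<in> p" for w
    unfolding V_def using that assms by (intro acl_iff_span) auto
  then show ?thesis by blast
qed

text \<open>Finitely many generators suffice because the differentials have a finite basis
  \<open>U\<close>. Each element of \<open>U\<close> lies in a point of \<open>Y\<close> and is
  replaced by a generator of that point in \<open>L\<close>.\<close>

lemma geom_cl_eq:
  assumes Y: "Y \<subseteq> geom K L" "\<Union>Y \<subseteq> M"
  shows "geom_cl K L Y = {p \<in> geom K L. p \<subseteq> acl K (\<Union>Y)}"
proof (intro equalityI subsetI)
  fix p assume "p \<in> geom_cl K L Y"
  then obtain l Z where l: "p = acl K {l}" "l \<in> L - alg_cl K" "\<forall>z\<in>Z. acl K {z} \<in> Y" "l \<in> acl K Z"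
    unfolding geom_cl_def by blast
  have "Z \<subseteq> \<Union>Y"
  proof
    fix z assume "z \<in> Z"
    with l(3) acl_superset(2)[of "{z}" K] show "z \<in> \<Union>Y" by auto
  qed
  then have "Z \<subseteq> acl K (\<Union>Y)" using acl_superset(2)[of "\<Union>Y" K] by simp
  then have "{l} \<subseteq> acl K (\<Union>Y)" using l(4) acl_subset_acl[of K Z "\<Union>Y"] by auto
  with l(1,2) show "p \<in> {p \<in> geom K L. p \<subseteq> acl K (\<Union>Y)}"
    unfolding geom_def by (auto simp: acl_subset_acl)
next
  fix p assume "p \<in> {p \<in> geom K L. p \<subseteq> acl K (\<Union>Y)}"
  then obtain l where l: "p = acl K {l}" "l \<in> L - alg_cl K" "p \<subseteq> acl K (\<Union>Y)"
    unfolding geom_def by blast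
  then have lY: "l \<in> acl K (\<Union>Y)" using acl_superset(2)[of "{l}" K] by auto
  then have lM: "l \<in> M" using acl_subset_M[OF Y(2)] by blast
  obtain U where U: "U \<subseteq> \<Union>Y" "finite U" "d ` \<Union>Y \<subseteq> vec.span (d ` U)"
    by (rule finite_basis[of "\<Union>Y"]) (rule that)
  have UM: "U \<subseteq> M" using U(1) Y(2) by blast
  have "d l \<in> vec.span (d ` \<Union>Y)" using lY lM acl_iff_span[OF Y(2)] by blast
  also have "\<dots> \<subseteq> vec.span (d ` U)" using U(3) by (intro vec.span_minimal) auto
  finally have "l \<in> acl K U" using acl_iff_span[OF UM lM] by simp
  have "\<exists>z. z \<in> L - alg_cl K \<and> acl K {z} \<in> Y \<and> u \<in> acl K {z}" if "u \<in> U" for u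
  proof -
    obtain q where "q \<in> Y" "u \<in> q" using \<open>u \<in> U\<close> U(1) by blast
    moreover from this Y(1) obtain z where "z \<in> L - alg_cl K" "q = acl K {z}"
      unfolding geom_def by blast
    ultimately show ?thesis by blast
  qed
  then obtain f where f: "\<And>u. u \<in> U \<Longrightarrow> f u \<in> L - alg_cl K \<and> acl K {f u} \<in> Y \<and> u \<in> acl K {f u}"
    by metis
  have "acl K {f u} \<subseteq> acl K (f ` U)" if "u \<in> U" for u
    unfolding acl_subset_acl using acl_superset(2)[of "f ` U" K] that by auto
  with f have "U \<subseteq> acl K (f ` U)" by blast
  then have "acl K U \<subseteq> acl K (f ` U)" by (simp add: acl_subset_acl)
  with \<open>l \<in> acl K U\<close> have "l \<in> acl K (f ` U)" ..
  then show "p \<in> geom_cl K L Y"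
    unfolding geom_cl_def using l f U(2) by (intro CollectI exI[of _ l] conjI exI[of _ "f ` U"]) auto
qed

text \<open>A set and its relative closure have the same span \<open>V\<close>, so a line is the
  trace of a two-dimensional subspace, recovered from the line itself.\<close>

lemma lines_of_iff:
  assumes X: "X \<subseteq> geom K L" "\<Union>X \<subseteq> M"
  shows "l \<in> lines_of K L X \<longleftrightarrow> l \<subseteq> X \<and> l = {p \<in> X. d ` p \<subseteq> V l} \<and> vec.dim (V l) = 2"
proof -
  have cl: "geom_cl K L Y \<inter> X = {p \<in> X. d ` p \<subseteq> V Y}" if "Y \<subseteq> X" for Y
  proof -
    have Y: "Y \<subseteq> geom K L" "\<Union>Y \<subseteq> M" using that X by auto
    have "p \<subseteq> acl K (\<Union>Y) \<longleftrightarrow> d ` p \<subseteq> V Y" if "p \<in> X" for p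
      using that X(2) Y by (intro subset_acl_iff) auto
    then show ?thesis
      unfolding geom_cl_eq[OF Y] using X(1) by blast
  qed
  have V_cl: "V {p \<in> X. d ` p \<subseteq> V Y} = V Y" if "Y \<subseteq> X" for Y
  proof
    show "V {p \<in> X. d ` p \<subseteq> V Y} \<subseteq> V Y" by (intro V_minimal V_subspace) auto
    show "V Y \<subseteq> V {p \<in> X. d ` p \<subseteq> V Y}" using that by (intro V_mono) (auto dest: V_superset)
  qed
  have rank: "geom_rank K l = 2 \<longleftrightarrow> vec.dim (V l) = 2" if "l \<subseteq> X" for l
  proof -
    have "\<Union>l \<subseteq> M" using that X(2) by blast
    then show ?thesis by (simp add: geom_rank_eq numeral_eq_enat)
  qed
  show ?thesis
  proof
    assume "l \<in> lines_of K L X"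
    then obtain Y where Y: "Y \<subseteq> X" "l = geom_cl K L Y \<inter> X" "geom_rank K l = 2"
      unfolding lines_of_def by blast
    have l: "l = {p \<in> X. d ` p \<subseteq> V Y}" using Y cl by simp
    with V_cl[OF Y(1)] have "V l = V Y" by simp
    with l have "l = {p \<in> X. d ` p \<subseteq> V l}" by simp
    moreover have "l \<subseteq> X" using l by blast
    ultimately show "l \<subseteq> X \<and> l = {p \<in> X. d ` p \<subseteq> V l} \<and> vec.dim (V l) = 2"
      using Y(3) rank by blast
  next
    assume *: "l \<subseteq> X \<and> l = {p \<in> X. d ` p \<subseteq> V l} \<and> vec.dim (V l) = 2"
    then have "l = geom_cl K L l \<inter> X" using cl[of l] by simp
    with * rank show "l \<in> lines_of K L X" unfolding lines_of_def by blast
  qed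
qed

lemma line_through:
  assumes X: "X \<subseteq> geom K L" "\<Union>X \<subseteq> M" and pq: "p \<in> X" "q \<in> X" "p \<noteq> q" "dir p v" "dir q w"
  shows "{r \<in> X. d ` r \<subseteq> vec.span {v, w}} \<in> lines_of K L X"
    and "V {r \<in> X. d ` r \<subseteq> vec.span {v, w}} = vec.span {v, w}"
proof -
  let ?l = "{r \<in> X. d ` r \<subseteq> vec.span {v, w}}"
  have "d ` p \<subseteq> vec.span {v, w}" "d ` q \<subseteq> vec.span {v, w}"
    using pq(4,5) by (simp_all add: dir_subset_iff vec.span_base)
  then have "{p, q} \<subseteq> ?l" using pq by auto
  then have "vec.span {v, w} \<subseteq> V ?l"
    using V_mono[of "{p, q}" ?l] V_pair[OF pq(4,5)] by simp
  moreover have "V ?l \<subseteq> vec.span {v, w}" by (rule V_minimal) auto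
  ultimately show V: "V ?l = vec.span {v, w}" by simp
  have "vec.dim {v, w} = 2"
    using dir_eq[OF pq(4,5)] pq(3) dir_nz[OF pq(4)] by (intro dim_pair) auto
  then show "?l \<in> lines_of K L X"
    unfolding lines_of_iff[OF X] V by (simp add: vec.dim_span)
qed

text \<open>This is the intersection axiom of the plane, translated to directions.\<close>

lemma lines_meet:
  assumes X: "is_proj_plane K L X" "\<Union>X \<subseteq> M"
    and p: "p1 \<in> X" "p2 \<in> X" "p1 \<noteq> p2" "dir p1 v1" "dir p2 v2"
    and q: "q1 \<in> X" "q2 \<in> X" "q1 \<noteq> q2" "dir q1 w1" "dir q2 w2"
  obtains r u where "r \<in> X" "dir r u" "u \<in> vec.span {v1, v2}" "u \<in> vec.span {w1, w2}"
proof -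
  have geom: "X \<subseteq> geom K L" using X(1) unfolding is_proj_plane_def by blast
  let ?l = "{r \<in> X. d ` r \<subseteq> vec.span {v1, v2}}" and ?m = "{r \<in> X. d ` r \<subseteq> vec.span {w1, w2}}"
  have "?l \<in> lines_of K L X" "?m \<in> lines_of K L X"
    using line_through(1)[OF geom X(2)] p q by blast+
  then have "?l \<inter> ?m \<noteq> {}" using X(1) unfolding is_proj_plane_def by blast
  then obtain r where r: "r \<in> X" "d ` r \<subseteq> vec.span {v1, v2}" "d ` r \<subseteq> vec.span {w1, w2}" by blast
  with X(2) geom obtain u where "dir r u" by (meson Sup_upper geom_dir order_trans subsetD)
  with r show ?thesis by (intro that) (auto simp: dir_subset_iff)
qed

end

section \<open>Projective planes containing the five points\<close>

lemma vector_3_axis: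
  "axis 1 1 = (vector [1, 0, 0] :: 'a::zero_neq_one ^ 3)"
  "axis 2 1 = (vector [0, 1, 0] :: 'a::zero_neq_one ^ 3)"
  "axis 3 1 = (vector [0, 0, 1] :: 'a::zero_neq_one ^ 3)"
  by (simp_all add: vec_eq_iff axis_def forall_3)

lemma not_aclI:
  fixes K :: "'a::field_char_0 set"
  shows "E \<in> ders K \<Longrightarrow> (\<And>s. s \<in> S \<Longrightarrow> E s = 0) \<Longrightarrow> E w \<noteq> 0 \<Longrightarrow> w \<notin> acl K S"
  unfolding acl_iff_ders by blast

context frame
begin

text \<open>An element outside \<open>M\<close> would extend \<open>b\<close> to an independent set
  of \<open>CARD('n) + 1\<close> elements. This confines a plane of rank 3 to
  \<open>M\<close>.\<close>

lemma subset_M_if_tr_deg_le: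
  assumes S: "range b \<subseteq> S" "tr_deg K (acl K S) \<le> enat CARD('n)"
  shows "S \<subseteq> M"
proof
  fix w assume "w \<in> S"
  show "w \<in> M"
  proof (rule ccontr)
    assume "w \<notin> M"
    then obtain E where E: "E \<in> ders K" "\<And>i. E (b i) = 0" "E w \<noteq> 0"
      unfolding M_def acl_iff_ders by auto
    let ?B = "insert w (range b)"
    have w: "w \<noteq> b i" for i using \<open>w \<notin> M\<close> b_in_M by auto
    have inj: "inj b" by (rule injI) (metis dual zero_neq_one)
    have "alg_indep K ?B"
      unfolding alg_indep_iff[OF K]
    proof
      fix v assume "v \<in> ?B"
      then consider "v = w" | i where "v = b i" by blast
      then show "v \<notin> acl K (?B - {v})"
      proof cases
        case 1
        show ?thesis
          by (rule not_aclI[OF E(1)]) (use 1 E(2,3) in auto)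
      next
        case (2 i)
        show ?thesis
        proof (rule not_aclI)
          \<comment> \<open>As \<open>E\<close> kills all \<open>b j\<close>, subtracting its
            multiple makes \<open>D i\<close> kill \<open>w\<close> without changing it on
            \<open>b\<close>. The index set \<open>{()}\<close> presents the single multiple as a
            sum.\<close>
          show "(\<lambda>u. D i u - (\<Sum>j\<in>{()}. D i w / E w * E u)) \<in> ders K"
            using D E(1) by (intro ders_minus_lincomb)
          show "D i s - (\<Sum>j\<in>{()}. D i w / E w * E s) = 0" if s: "s \<in> ?B - {v}" for s
          proof (cases "s = w")
            case False
            then obtain j where j: "s = b j" using s by blast
            with s 2 have "j \<noteq> i" by auto
            then show ?thesis by (simp add: j dual E(2))
          qed (use E(3) in simp)
          show "D i v - (\<Sum>j\<in>{()}. D i w / E w * E v) \<noteq> 0" by (simp add: 2 dual E(2))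
        qed
      qed
    qed
    moreover have "?B \<subseteq> acl K S" using S(1) \<open>w \<in> S\<close> acl_superset(2)[of S K] by blast
    moreover have "finite ?B" by simp
    ultimately have "enat (card ?B) \<le> tr_deg K (acl K S)"
      unfolding tr_deg_def by (intro SUP_upper) blast
    also have "card ?B = Suc (CARD('n))"
      using w card_image[OF inj] by (subst card_insert_disjoint) auto
    finally show False using S(2) by (metis enat_ord_simps(1) not_less_eq_eq order_refl order_trans)
  qed
qed

text \<open>
  A point whose direction has vanishing \<open>k\<close>-th coordinate lies in the closure of the remaining
  coordinates, which is stable under all \<open>D i\<close>; hence so do the ratios of its coordinates.
\<close>

lemma dir_ratio:
  assumes p: "dir p v" "v $ k = 0"
  shows "v $ i / v $ j \<in> M" and "D k (v $ i / v $ j) = 0"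
proof -
  obtain l t where l: "l \<in> M" "t \<noteq> 0" "d l = t *s v"
    using p(1) unfolding dir_def by blast
  let ?S = "b ` (- {k})"
  \<comment> \<open>In the expansion of \<open>E l\<close> the term of \<open>k\<close> vanishes
    with the coordinate, the others with \<open>E (b i)\<close>.\<close>
  have lS: "l \<in> acl K ?S"
    unfolding acl_iff_ders
  proof (intro ballI impI)
    fix E assume E: "E \<in> ders K" "\<forall>s\<in>?S. E s = 0"
    have zero: "E (b i) * d l $ i = 0" for i
      using E(2) l(3) p(2) by (cases "i = k") auto
    show "E l = 0"
      unfolding ders_expand[OF E(1) l(1)] by (intro sum.neutral ballI zero)
  qed
  have *: "D m l \<in> acl K ?S" for m
  proof (rule acl_closed_derivation[OF D _ is_subfield_acl acl_superset lS lS])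
    show "D m s \<in> adjoin K ?S" if "s \<in> ?S" for s
    proof -
      obtain j where "s = b j" using \<open>s \<in> ?S\<close> by blast
      then show ?thesis
        using is_subfieldD(1,2)[OF is_subfield_adjoin[of K ?S]] by (cases "m = j") (auto simp: dual)
    qed
  qed
  have "v $ i / v $ j = D i l / D j l"
    using l(2,3) by (simp add: d_nth[symmetric])
  with * have "v $ i / v $ j \<in> acl K ?S"
    by (simp add: is_subfield_divide[OF is_subfield_acl])
  moreover have "?S \<subseteq> M" using b_in_M by auto
  ultimately show "v $ i / v $ j \<in> M" using acl_subset_M by blast
  show "D k (v $ i / v $ j) = 0"
    using \<open>v $ i / v $ j \<in> acl K ?S\<close> D[of k] unfolding acl_iff_ders by (auto simp: dual)
qed

end

section \<open>Projections in a plane through the five points\<close>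

locale frame3 = frame K b D for K :: "'a::field_char_0 set" and b :: "3 \<Rightarrow> 'a" and D
begin

definition has_dir :: "'a set set \<Rightarrow> 'a \<Rightarrow> 'a \<Rightarrow> 'a \<Rightarrow> bool" where
  "has_dir X s t r \<longleftrightarrow> (\<exists>p\<in>X. dir p (vector [s, t, r]))"

lemma has_dir_scale: "has_dir X s t r \<Longrightarrow> c \<noteq> 0 \<Longrightarrow> has_dir X (c * s) (c * t) (c * r)"
proof -
  assume "has_dir X s t r" "c \<noteq> 0"
  then obtain p where "p \<in> X" "dir p (c *s vector [s, t, r])"
    unfolding has_dir_def using dir_scale by blast
  moreover have "c *s vector [s, t, r] = (vector [c * s, c * t, c * r] :: 'a ^ 3)"
    by (simp add: vec_eq_iff forall_3)
  ultimately show ?thesis unfolding has_dir_def by auto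
qed

lemma has_dir_normalize:
  assumes "has_dir X (e * s) (e * t) (e * r)" "e \<noteq> 0"
  shows "has_dir X s t r"
  using has_dir_scale[OF assms(1), of "1 / e"] assms(2) by simp

text \<open>Keeping both descriptions of the intersection point yields linear equations from which
  each projection below finds its coefficients.\<close>

lemma has_dir_meet:
  assumes X: "is_proj_plane K L X" "\<Union>X \<subseteq> M"
    and p: "has_dir X s1 t1 r1" "has_dir X s2 t2 r2" "\<And>c. \<not> (s2 = c * s1 \<and> t2 = c * t1 \<and> r2 = c * r1)"
    and q: "has_dir X s3 t3 r3" "has_dir X s4 t4 r4" "\<And>c. \<not> (s4 = c * s3 \<and> t4 = c * t3 \<and> r4 = c * r3)"
  obtains e f g h where
    "has_dir X (e * s1 + f * s2) (e * t1 + f * t2) (e * r1 + f * r2)"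
    "(e * s1 + f * s2, e * t1 + f * t2, e * r1 + f * r2) \<noteq> (0, 0, 0)"
    "e * s1 + f * s2 = g * s3 + h * s4" "e * t1 + f * t2 = g * t3 + h * t4"
    "e * r1 + f * r2 = g * r3 + h * r4"
proof -
  obtain p1 p2 where p': "p1 \<in> X" "p2 \<in> X" "dir p1 (vector [s1, t1, r1])" "dir p2 (vector [s2, t2, r2])"
    using p(1,2) unfolding has_dir_def by blast
  obtain q1 q2 where q': "q1 \<in> X" "q2 \<in> X" "dir q1 (vector [s3, t3, r3])" "dir q2 (vector [s4, t4, r4])"
    using q(1,2) unfolding has_dir_def by blast
  have "p1 \<noteq> p2" "q1 \<noteq> q2"
    unfolding dir_eq[OF p'(3,4)] dir_eq[OF q'(3,4)] using p(3) q(3) by (auto simp: vec_eq_iff forall_3)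
  then obtain r u where u: "r \<in> X" "dir r u"
    "u \<in> vec.span {vector [s1, t1, r1], vector [s2, t2, r2]}"
    "u \<in> vec.span {vector [s3, t3, r3], vector [s4, t4, r4]}"
    using lines_meet[OF X p'(1,2) _ p'(3,4) q'(1,2) _ q'(3,4)] by blast
  from u(3,4) obtain e f g h where
    "u = e *s vector [s1, t1, r1] + f *s vector [s2, t2, r2]"
    "u = g *s vector [s3, t3, r3] + h *s vector [s4, t4, r4]"
    unfolding in_span_pair by blast
  then have e: "u = vector [e * s1 + f * s2, e * t1 + f * t2, e * r1 + f * r2]"
    and g: "u = vector [g * s3 + h * s4, g * t3 + h * t4, g * r3 + h * r4]"
    by (simp_all add: vec_eq_iff forall_3)
  have nz: "(e * s1 + f * s2, e * t1 + f * t2, e * r1 + f * r2) \<noteq> (0, 0, 0)"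
  proof
    assume "(e * s1 + f * s2, e * t1 + f * t2, e * r1 + f * r2) = (0, 0, 0)"
    with e have "u = 0" by (simp add: vec_eq_iff forall_3)
    with u(2) dir_nz show False by blast
  qed
  have "has_dir X (e * s1 + f * s2) (e * t1 + f * t2) (e * r1 + f * r2)"
    using u(1,2) e unfolding has_dir_def by blast
  then show ?thesis
  proof (rule that[OF _ nz])
    show "e * s1 + f * s2 = g * s3 + h * s4" "e * t1 + f * t2 = g * t3 + h * t4"
      "e * r1 + f * r2 = g * r3 + h * r4"
      using e g by (simp_all add: vec_eq_iff forall_3)
  qed
qed

context
  fixes L X
  assumes X: "is_proj_plane K L X" "\<Union>X \<subseteq> M"
    and e1: "has_dir X 1 0 0" and e2: "has_dir X 0 1 0" and e3: "has_dir X 0 0 1"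
    and e12: "has_dir X 1 1 0" and e13: "has_dir X 1 0 1"
begin

text \<open>\<open>(0, 1, -1) = (1, 1, 0) - (1, 0, 1)\<close> lies on the joins of two pairs of
  given points.\<close>

lemma centre: "has_dir X 0 1 (- 1)"
proof -
  obtain e f g h where *: "has_dir X (e * 0 + f * 0) (e * 1 + f * 0) (e * 0 + f * 1)"
    "(e * 0 + f * 0, e * 1 + f * 0, e * 0 + f * 1) \<noteq> (0, 0, 0)"
    "e * 0 + f * 0 = g * 1 + h * 1" "e * 1 + f * 0 = g * 1 + h * 0" "e * 0 + f * 1 = g * 0 + h * 1"
    by (rule has_dir_meet[OF X e2 e3 _ e12 e13]) (auto intro: that)
  then have f: "f = - e" and e: "e \<noteq> 0" by (auto simp: add_eq_0_iff)
  show ?thesis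
    by (rule has_dir_normalize[OF _ e]) (use *(1) f in simp)
qed

text \<open>Projection from \<open>centre\<close>:
  \<open>(1, 0, s) = (1, s, 0) - s (0, 1, -1)\<close>.\<close>

lemma slope_12_13: "has_dir X 1 s 0 \<Longrightarrow> has_dir X 1 0 s"
proof -
  assume p: "has_dir X 1 s 0"
  obtain e f g h where *: "has_dir X (e * 1 + f * 0) (e * s + f * 1) (e * 0 + f * - 1)"
    "(e * 1 + f * 0, e * s + f * 1, e * 0 + f * - 1) \<noteq> (0, 0, 0)"
    "e * 1 + f * 0 = g * 1 + h * 0" "e * s + f * 1 = g * 0 + h * 0" "e * 0 + f * - 1 = g * 0 + h * 1"
    by (rule has_dir_meet[OF X p centre _ e1 e3]) (auto intro: that)
  then have f: "f = - (e * s)" and e: "e \<noteq> 0" by (auto simp: add_eq_0_iff)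
  show ?thesis
    by (rule has_dir_normalize[OF _ e]) (use *(1) f in simp)
qed

text \<open>The inverse projection, from the same point.\<close>

lemma slope_13_12: "has_dir X 1 0 s \<Longrightarrow> has_dir X 1 s 0"
proof -
  assume p: "has_dir X 1 0 s"
  obtain e f g h where *: "has_dir X (e * 1 + f * 0) (e * 0 + f * 1) (e * s + f * - 1)"
    "(e * 1 + f * 0, e * 0 + f * 1, e * s + f * - 1) \<noteq> (0, 0, 0)"
    "e * 1 + f * 0 = g * 1 + h * 0" "e * 0 + f * 1 = g * 0 + h * 1" "e * s + f * - 1 = g * 0 + h * 0"
    by (rule has_dir_meet[OF X p centre _ e1 e2]) (auto intro: that)
  then have f: "f = e * s" and e: "e \<noteq> 0" by auto
  show ?thesis
    by (rule has_dir_normalize[OF _ e]) (use *(1) f in simp)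
qed

text \<open>Projection from \<open>(1, 0, 1)\<close>:
  \<open>(0, s, -1) = (1, s, 0) - (1, 0, 1)\<close>.\<close>

lemma slope_12_23: "has_dir X 1 s 0 \<Longrightarrow> has_dir X 0 s (- 1)"
proof -
  assume p: "has_dir X 1 s 0"
  obtain e f g h where *: "has_dir X (e * 1 + f * 1) (e * s + f * 0) (e * 0 + f * 1)"
    "(e * 1 + f * 1, e * s + f * 0, e * 0 + f * 1) \<noteq> (0, 0, 0)"
    "e * 1 + f * 1 = g * 0 + h * 0" "e * s + f * 0 = g * 1 + h * 0" "e * 0 + f * 1 = g * 0 + h * 1"
    by (rule has_dir_meet[OF X p e13 _ e2 e3]) (auto intro: that)
  then have f: "f = - e" and e: "e \<noteq> 0" by (auto simp: add_eq_0_iff)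
  show ?thesis
    by (rule has_dir_normalize[OF _ e]) (use *(1) f in simp)
qed

text \<open>Back along \<open>(1, 0, 1)\<close>:
  \<open>(-s, 1, 0) = (0, 1, s) - s (1, 0, 1)\<close>.\<close>

lemma slope_23_12: "has_dir X 0 1 s \<Longrightarrow> has_dir X (- s) 1 0"
proof -
  assume p: "has_dir X 0 1 s"
  obtain e f g h where *: "has_dir X (e * 0 + f * 1) (e * 1 + f * 0) (e * s + f * 1)"
    "(e * 0 + f * 1, e * 1 + f * 0, e * s + f * 1) \<noteq> (0, 0, 0)"
    "e * 0 + f * 1 = g * 1 + h * 0" "e * 1 + f * 0 = g * 0 + h * 1" "e * s + f * 1 = g * 0 + h * 0"
    by (rule has_dir_meet[OF X p e13 _ e1 e2]) (auto intro: that)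
  then have f: "f = - (e * s)" and e: "e \<noteq> 0" by (auto simp: add_eq_0_iff)
  show ?thesis
    by (rule has_dir_normalize[OF _ e]) (use *(1) f in simp)
qed

text \<open>The slope occurs in points on all three coordinate lines; by \<open>dir_ratio\<close>
  each of them makes one partial derivative of \<open>s\<close> vanish.\<close>

lemma slope_constant:
  assumes "has_dir X 1 s 0"
  shows "s \<in> alg_cl K"
proof -
  have s: "s \<in> M \<and> D 3 s = 0"
    using assms dir_ratio[of _ "vector [1, s, 0]" 3 2 1] unfolding has_dir_def by auto
  moreover have "D 2 s = 0"
    using slope_12_13[OF assms] dir_ratio[of _ "vector [1, 0, s]" 2 3 1] unfolding has_dir_def by auto
  moreover have "D 1 s = 0"
    using slope_12_23[OF assms] dir_ratio[of _ "vector [0, s, - 1]" 1 2 3]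
    unfolding has_dir_def by (auto simp: derivationD[OF dersD(1)[OF D]])
  ultimately have "d s = 0" by (simp add: vec_eq_iff forall_3 d_nth)
  with s d_eq_0_iff show ?thesis by blast
qed

lemma plane_rational_dir:
  assumes p: "p \<in> X"
  obtains v where "dir p v" "\<And>i. v $ i \<in> alg_cl K"
proof -
  have k: "is_subfield (alg_cl K)" unfolding alg_cl_eq_acl[OF K] by (rule is_subfield_acl)
  have "X \<subseteq> geom K L" using X(1) unfolding is_proj_plane_def by (rule conjunct1)
  then have pM: "p \<in> geom K L" "p \<subseteq> M" using X(2) p by auto
  obtain v where v: "dir p v" by (rule geom_dir[OF pM])
  note result = that
  have v_eq: "v = vector [v $ 1, v $ 2, v $ 3]" by (simp add: vec_eq_iff forall_3)
  have fin: thesis if "c \<noteq> 0" "c * v $ 1 \<in> alg_cl K" "c * v $ 2 \<in> alg_cl K" "c * v $ 3 \<in> alg_cl K" for c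
  proof (rule result[OF dir_scale[OF v \<open>c \<noteq> 0\<close>]])
    show "(c *s v) $ i \<in> alg_cl K" for i
      using \<open>c * v $ 1 \<in> alg_cl K\<close> \<open>c * v $ 2 \<in> alg_cl K\<close> \<open>c * v $ 3 \<in> alg_cl K\<close>
      using exhaust_3[of i] by auto
  qed
  have on_v: "has_dir X (v $ 1) (v $ 2) (v $ 3)" using p v v_eq unfolding has_dir_def by metis
  consider "v $ 1 \<noteq> 0" | "v $ 1 = 0" "v $ 2 \<noteq> 0" | "v $ 1 = 0" "v $ 2 = 0" by blast
  then show thesis
  proof cases
    case 1
    define s t where "s = v $ 2 / v $ 1" and "t = v $ 3 / v $ 1"
    have st: "has_dir X 1 s t" using has_dir_scale[OF on_v, of "1 / v $ 1"] 1 by (simp add: s_def t_def)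
    \<comment> \<open>Projection from the third axis point isolates \<open>s\<close>.\<close>
    obtain e f g h where *: "has_dir X (e * 1 + f * 0) (e * s + f * 0) (e * t + f * 1)"
      "(e * 1 + f * 0, e * s + f * 0, e * t + f * 1) \<noteq> (0, 0, 0)"
      "e * 1 + f * 0 = g * 1 + h * 0" "e * s + f * 0 = g * 0 + h * 1" "e * t + f * 1 = g * 0 + h * 0"
      by (rule has_dir_meet[OF X st e3 _ e1 e2]) (auto intro: that)
    then have e: "e \<noteq> 0" and zero: "e * t + f = 0" by auto
    have "has_dir X 1 s 0" by (rule has_dir_normalize[OF _ e]) (use *(1) zero in simp)
    then have s: "s \<in> alg_cl K" by (rule slope_constant)
    \<comment> \<open>Projection from the second axis point isolates \<open>t\<close>, which
      \<open>slope_13_12\<close> then moves to the line of the first two axes.\<close>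
    obtain e f g h where *: "has_dir X (e * 1 + f * 0) (e * s + f * 1) (e * t + f * 0)"
      "(e * 1 + f * 0, e * s + f * 1, e * t + f * 0) \<noteq> (0, 0, 0)"
      "e * 1 + f * 0 = g * 1 + h * 0" "e * s + f * 1 = g * 0 + h * 0" "e * t + f * 0 = g * 0 + h * 1"
      by (rule has_dir_meet[OF X st e2 _ e1 e3]) (auto intro: that)
    then have e: "e \<noteq> 0" and zero: "e * s + f = 0" by auto
    have "has_dir X 1 0 t" by (rule has_dir_normalize[OF _ e]) (use *(1) zero in simp)
    then have "t \<in> alg_cl K" by (intro slope_constant slope_13_12)
    with s 1 is_subfieldD(2)[OF k] show ?thesis by (intro fin[of "1 / v $ 1"]) (auto simp: s_def t_def)
  next
    case 2
    define s where "s = v $ 3 / v $ 2"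
    have "has_dir X 0 1 s" using has_dir_scale[OF on_v, of "1 / v $ 2"] 2 by (simp add: s_def)
    then have s1: "has_dir X (- s) 1 0" by (rule slope_23_12)
    have "s \<in> alg_cl K"
    \<comment> \<open>Normalising \<open>(-s, 1, 0)\<close> gives the slope \<open>-1/s\<close>,
      which requires \<open>s\<close> to be nonzero.\<close>
    proof (cases "s = 0")
      case False
      then have "has_dir X 1 (- (1 / s)) 0" using has_dir_scale[OF s1, of "- (1 / s)"] by simp
      then have "- (1 / s) \<in> alg_cl K" by (rule slope_constant)
      then show ?thesis
        using is_subfieldD(5)[OF k, of "- (1 / s)"] is_subfieldD(6)[OF k, of "1 / s"] by simp
    qed (use is_subfieldD(1)[OF k] in simp)
    with 2 is_subfieldD(1,2)[OF k] show ?thesis by (intro fin[of "1 / v $ 2"]) (auto simp: s_def)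
  next
    case 3
    with dir_nz[OF v] have "v $ 3 \<noteq> 0" by (auto simp: vec_eq_iff forall_3)
    with 3 is_subfieldD(1,2)[OF k] show ?thesis by (intro fin[of "1 / v $ 3"]) auto
  qed
qed

end

end

section \<open>Points defined over \<open>L\<close>\<close>

context frame
begin

definition lincomb :: "'a ^ 'n \<Rightarrow> 'a" where "lincomb v = (\<Sum>i\<in>UNIV. v $ i * b i)"

lemma subfield_alg_cl: "is_subfield (alg_cl K)"
  unfolding alg_cl_eq_acl[OF K] by (rule is_subfield_acl)

lemma lincomb_in_M: "(\<And>i. v $ i \<in> alg_cl K) \<Longrightarrow> lincomb v \<in> M"
  unfolding lincomb_def using alg_cl_subset_M
  by (intro is_subfield_sum is_subfieldD(4) subfield_M b_in_M) auto

lemma d_lincomb: "(\<And>i. v $ i \<in> alg_cl K) \<Longrightarrow> d (lincomb v) = v"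
proof -
  assume v: "\<And>i. v $ i \<in> alg_cl K"
  have "D j (v $ i * b i) = (if i = j then v $ j else 0)" for i j
    using ders_alg_cl[OF D K v] by (auto simp: derivationD(2)[OF dersD(1)[OF D]] dual)
  then show ?thesis
    by (simp add: vec_eq_iff d_nth lincomb_def derivation_sum[OF dersD(1)[OF D]])
qed

lemma dir_lincomb: "(\<And>i. v $ i \<in> alg_cl K) \<Longrightarrow> v \<noteq> 0 \<Longrightarrow> dir (acl K {lincomb v}) v"
  using dirI[of "lincomb v"] lincomb_in_M[of v] d_lincomb[of v] by simp

end

text \<open>
  The elements \<open>\<Lambda> i\<close> and \<open>\<mu> i\<close> of \<open>L\<close> represent the points of the coordinate axes and the
  points with direction \<open>e\<^sub>i + e\<^bsub>i0\<^esub>\<close>.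
\<close>

locale rational_frame = frame K b D
  for K :: "'a::field_char_0 set" and b :: "'n::finite \<Rightarrow> 'a" and D +
  fixes L :: "'a set" and \<Lambda> \<mu> :: "'n \<Rightarrow> 'a" and i0 :: 'n
  assumes L: "is_subfield L" and KL: "K \<subseteq> L"
    and \<Lambda>: "\<And>i. \<Lambda> i \<in> L" "\<And>i. \<Lambda> i \<in> M" "\<And>i j. D j (\<Lambda> i) \<noteq> 0 \<longleftrightarrow> j = i"
    and \<mu>: "\<And>i. \<mu> i \<in> L" "\<And>i. \<mu> i \<in> M" "\<And>i. D i (\<mu> i) = D i0 (\<mu> i)" "\<And>i. D i (\<mu> i) \<noteq> 0"
begin

definition g :: "'n \<Rightarrow> 'a" where "g i = D i (\<Lambda> i)"

text \<open>These are the derivations dual to \<open>\<Lambda>\<close>, that is, partial derivatives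
  in a second transcendence basis of \<open>M\<close>.\<close>

definition E :: "'n \<Rightarrow> 'a \<Rightarrow> 'a" where "E i w = D i w / g i"

definition N :: "'a set" where "N = L \<inter> M"

lemma g_nz: "g i \<noteq> 0"
  unfolding g_def using \<Lambda>(3) by blast

lemma subfield_N: "is_subfield N"
  unfolding N_def using is_subfield_Inter[of "{L, M}"] L subfield_M by auto

lemma E_ders: "E i \<in> ders K"
  using ders_lincomb[of "{i}" D K "\<lambda>_. 1 / g i"] D by (simp add: E_def[abs_def])

text \<open>The differential of \<open>\<Lambda> j\<close> is a nonzero multiple of that of
  \<open>b j\<close>, so a derivation killing \<open>\<Lambda> j\<close> kills
  \<open>b j\<close>.\<close>

lemma M_subset_acl: "M \<subseteq> acl K (range \<Lambda>)"
proof
  fix w assume w: "w \<in> M"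
  show "w \<in> acl K (range \<Lambda>)"
    unfolding acl_iff_ders
  proof (intro ballI impI)
    fix F assume F: "F \<in> ders K" "\<forall>s\<in>range \<Lambda>. F s = 0"
    have "F (b j) = 0" for j
    proof -
      have "F (\<Lambda> j) = (\<Sum>i\<in>UNIV. if i = j then F (b j) * g j else 0)"
        unfolding ders_expand[OF F(1) \<Lambda>(2)[of j]]
        by (rule sum.cong) (use \<Lambda>(3)[of _ j] in \<open>auto simp: d_nth g_def\<close>)
      then show ?thesis using F(2) g_nz[of j] by simp
    qed
    then show "F w = 0" unfolding ders_expand[OF F(1) w] by simp
  qed
qed

text \<open>\<open>N\<close> is algebraic over \<open>adjoin K (range \<Lambda>)\<close>, and
  \<open>E i\<close> takes only the values 0 and 1 on \<open>\<Lambda>\<close>.\<close>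

lemma E_in_N: "c \<in> N \<Longrightarrow> E i c \<in> N"
proof (rule acl_closed_derivation[OF E_ders _ subfield_N])
  show "E i s \<in> adjoin K (range \<Lambda>)" if "s \<in> range \<Lambda>" for s
  proof -
    obtain j where "s = \<Lambda> j" using \<open>s \<in> range \<Lambda>\<close> by blast
    then have "E i s = (if i = j then 1 else 0)"
      using \<Lambda>(3)[of i j] g_nz[of i] by (auto simp: E_def g_def)
    then show ?thesis using is_subfieldD(1,2)[OF is_subfield_adjoin[of K "range \<Lambda>"]] by simp
  qed
  show "K \<subseteq> N"
    using KL alg_cl_superset[OF K] alg_cl_subset_M unfolding N_def by blast
  show "range \<Lambda> \<subseteq> N" using \<Lambda>(1,2) unfolding N_def by blast
  show "c \<in> N \<Longrightarrow> c \<in> acl K (range \<Lambda>)" using M_subset_acl unfolding N_def by blast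
qed

text \<open>Up to the common factor \<open>1 / g i0\<close>, a form with coefficients
  \<open>v $ i\<close> in the differentials of \<open>b\<close> has coefficients
  \<open>v $ i * h i\<close> in those of \<open>\<Lambda>\<close>.\<close>

definition h :: "'n \<Rightarrow> 'a" where "h i = g i0 / g i"

lemma h_nz: "h i \<noteq> 0"
  unfolding h_def using g_nz by simp

text \<open>The points beyond the axes enter here: two partial derivatives of \<open>\<mu> i\<close>
  in the basis \<open>b\<close> agree, so their ratio in the basis \<open>\<Lambda>\<close> is
  \<open>h i\<close>.\<close>

lemma h_in_N: "h i \<in> N"
proof -
  have "\<mu> i \<in> N" using \<mu>(1,2) unfolding N_def by blast
  then have "E i (\<mu> i) / E i0 (\<mu> i) \<in> N" by (intro is_subfield_divide subfield_N E_in_N)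
  moreover have "E i (\<mu> i) / E i0 (\<mu> i) = h i"
    using \<mu>(3,4)[of i] g_nz[of i] g_nz[of i0] by (simp add: E_def h_def field_simps)
  ultimately show ?thesis by simp
qed

text \<open>A generator in \<open>L\<close> has its derivatives \<open>E i l\<close> in
  \<open>N\<close>; the factors \<open>h\<close> convert their ratios into those of
  \<open>v\<close>.\<close>

lemma dir_ratio_in_L:
  assumes p: "p \<in> geom K L" "dir p v" and j: "v $ j \<noteq> 0"
  shows "v $ i / v $ j \<in> L"
proof -
  obtain l w where l: "dir p w" "l \<in> L" "p = acl K {l}" "d l = w"
    by (rule geom_dir[OF p(1) dir_subset_M[OF p(2)]]) (rule that)
  obtain t where t: "t \<noteq> 0" "w = t *s v" using dir_mult[OF p(2) l(1)] by blast
  have "l \<in> N"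
    using l(2,3) dir_subset_M[OF p(2)] acl_superset(2)[of "{l}" K] unfolding N_def by auto
  then have "(E i l / E j l) * (h j / h i) \<in> N"
    by (intro is_subfieldD(4) is_subfield_divide subfield_N E_in_N h_in_N)
  moreover have "E i l = t * v $ i / g i" for i
    using l(4) t(2) by (simp add: E_def d_nth[symmetric])
  then have "(E i l / E j l) * (h j / h i) = v $ i / v $ j"
    using t(1) j g_nz[of i] g_nz[of j] g_nz[of i0] by (simp add: h_def field_simps)
  ultimately show ?thesis unfolding N_def by simp
qed

text \<open>
  The coefficients of the minimal polynomial of \<open>u\<close> over \<open>L \<inter> M\<close> are killed by every derivation
  that kills \<open>u\<close> and maps \<open>L \<inter> M\<close> to itself. Since the differential of \<open>u\<close> is rational up to a
  scalar factor, these derivations cut out the closure of \<open>u\<close>.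
\<close>

lemma lincomb_in_geom:
  assumes v: "v \<noteq> 0" "\<And>i. v $ i \<in> alg_cl K" "\<And>i. v $ i \<in> L"
  shows "acl K {lincomb v} \<in> geom K L"
proof -
  let ?u = "lincomb v"
  have u: "?u \<in> M" "d ?u = v" using lincomb_in_M d_lincomb v(2) by auto
  define \<beta> where "\<beta> i = v $ i * h i" for i
  have \<beta>: "\<beta> i \<in> N" for i
    unfolding \<beta>_def
  proof (intro is_subfieldD(4) subfield_N h_in_N)
    show "v $ i \<in> N" using v(2,3) alg_cl_subset_M unfolding N_def by blast
  qed
  have E_u: "E i ?u = \<beta> i / g i0" for i
    using u(2) g_nz[of i0] g_nz[of i] by (simp add: E_def d_nth[symmetric] \<beta>_def h_def)
  have "adjoin K (range \<Lambda>) \<subseteq> N"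
    using KL alg_cl_superset[OF K] alg_cl_subset_M \<Lambda>(1,2)
    by (intro adjoin_least subfield_N) (auto simp: N_def)
  then have "?u \<in> alg_cl N"
    using M_subset_acl u(1) unfolding acl_def alg_cl_def by blast
  then obtain p where p: "\<And>i. coeff p i \<in> N" "poly p ?u = 0" "lead_coeff p = 1" "poly (pderiv p) ?u \<noteq> 0"
    and min: "\<And>q. (\<And>i. coeff q i \<in> N) \<Longrightarrow> poly q ?u = 0 \<Longrightarrow> degree q < degree p \<Longrightarrow> q = 0"
    by (rule minimal_relation[OF subfield_N]) (rule that; blast)
  have proportional: "\<beta> j * E i (coeff p k) = \<beta> i * E j (coeff p k)" for i j k
  proof -
    \<comment> \<open>\<open>T\<close> kills \<open>?u\<close>, whose derivatives
      \<open>E i ?u\<close> are proportional to \<open>\<beta> i\<close>, and it maps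
      \<open>N\<close> to itself.\<close>
    define T where "T w = \<beta> j * E i w - \<beta> i * E j w" for w
    have "(\<lambda>w. \<Sum>s\<in>UNIV. (if s then \<beta> j else - \<beta> i) * (if s then E i else E j) w) \<in> ders K"
      by (rule ders_lincomb) (auto simp: E_ders)
    then have T: "T \<in> ders K" by (simp add: UNIV_bool T_def[abs_def])
    note T' = dersD(1)[OF T]
    have "poly (map_poly T p) ?u = 0"
      using derivation_poly[OF T', of p ?u] p(2) derivationD(3)[OF T'] by (simp add: T_def E_u)
    moreover have coeff_T: "coeff (map_poly T p) m = T (coeff p m)" for m
      by (simp add: coeff_map_poly derivationD(3)[OF T'])
    moreover have "T (coeff p m) \<in> N" for m
      unfolding T_def by (intro is_subfieldD(4,7) subfield_N \<beta> E_in_N p(1))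
    moreover have "degree p \<noteq> 0"
    proof
      assume "degree p = 0"
      then obtain c where "p = [:c:]" by (rule degree_eq_zeroE)
      with p(4) show False by simp
    qed
    \<comment> \<open>Since \<open>p\<close> is monic and \<open>T 1 = 0\<close>, the degree drops;
      minimality then makes \<open>map_poly T p\<close> zero.\<close>
    have "degree (map_poly T p) < degree p"
    proof (rule degree_lessI)
      show "map_poly T p \<noteq> 0 \<or> degree p > 0" using \<open>degree p \<noteq> 0\<close> by simp
      show "\<forall>k\<ge>degree p. coeff (map_poly T p) k = 0"
      proof (intro allI impI)
        fix k assume "degree p \<le> k"
        then have "coeff p k = 0 \<or> coeff p k = 1"
          using p(3) coeff_eq_0[of p k] by (cases "k = degree p") auto
        then show "coeff (map_poly T p) k = 0"
          unfolding coeff_T using derivationD(3,4)[OF T'] by auto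
      qed
    qed
    ultimately have "map_poly T p = 0" by (intro min) auto
    then have "T (coeff p k) = 0" using coeff_T[of k] by simp
    then show ?thesis by (simp add: T_def)
  qed
  obtain j where j: "v $ j \<noteq> 0" using v(1) by (auto simp: vec_eq_iff)
  then have \<beta>j: "\<beta> j \<noteq> 0" unfolding \<beta>_def using h_nz by simp
  have d_coeff: "\<exists>t. d (coeff p k) = t *s v" for k
  proof (intro exI)
    have "D i (coeff p k) = E j (coeff p k) / \<beta> j * g i0 * v $ i" for i
      using proportional[of j i k] \<beta>j g_nz[of i] g_nz[of i0]
      by (simp add: E_def \<beta>_def h_def field_simps)
    then show "d (coeff p k) = (E j (coeff p k) / \<beta> j * g i0) *s v"
      by (simp add: vec_eq_iff d_nth)
  qed
  \<comment> \<open>With constant coefficients only, differentiating \<open>p\<close> at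
    \<open>?u\<close> would leave \<open>p'(u) D j u = 0\<close>, against separability and
    \<open>v $ j \<noteq> 0\<close>.\<close>
  have "\<exists>k. coeff p k \<notin> alg_cl K"
  proof (rule ccontr)
    assume "\<not> ?thesis"
    then have "map_poly (D j) p = 0"
      using ders_alg_cl[OF D K] by (intro poly_eqI) (simp add: coeff_map_poly derivationD(3)[OF dersD(1)[OF D]])
    then have "D j ?u = 0"
      using derivation_poly[OF dersD(1)[OF D], of j p ?u] p(2,4) derivationD(3)[OF dersD(1)[OF D]] by simp
    with j u(2) show False by (simp add: d_nth[symmetric])
  qed
  then obtain k where k: "coeff p k \<notin> alg_cl K" ..
  let ?c = "coeff p k"
  have c: "?c \<in> L" "?c \<in> M" using p(1)[of k] unfolding N_def by auto
  then have "d ?c \<noteq> 0" using k d_eq_0_iff by blast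
  then have "acl K {?u} = acl K {?c}"
    using dir_eq[OF dir_lincomb[OF v(2,1)] dirI[OF c(2)]] d_coeff[of k] by blast
  with c(1) k show ?thesis unfolding geom_def by blast
qed

end

section \<open>The plane over a subfield of the constants\<close>

text \<open>Cramer's rule for a nonzero minor of \<open>u\<close> and \<open>v\<close>.\<close>

lemma lincomb_coeffs_in_subfield:
  fixes u v w :: "'a::field ^ 'n"
  assumes F: "is_subfield F" and uvw: "\<And>i. u $ i \<in> F" "\<And>i. v $ i \<in> F" "\<And>i. w $ i \<in> F"
    and u: "u \<noteq> 0" and v: "\<And>t. v \<noteq> t *s u" and w: "w = s *s u + t *s v"
  shows "s \<in> F" "t \<in> F"
proof -
  obtain i where i: "u $ i \<noteq> 0" using u by (auto simp: vec_eq_iff)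
  obtain j where j: "u $ i * v $ j - u $ j * v $ i \<noteq> 0"
  proof (rule ccontr)
    assume "\<not> thesis"
    then have "u $ i * v $ j = u $ j * v $ i" for j using that by fastforce
    then have "v = (v $ i / u $ i) *s u" using i by (auto simp: vec_eq_iff field_simps)
    with v show False by blast
  qed
  have "w $ i = s * u $ i + t * v $ i" "w $ j = s * u $ j + t * v $ j" using w by simp_all
  then have "s * (u $ i * v $ j - u $ j * v $ i) = w $ i * v $ j - w $ j * v $ i"
    and "t * (u $ i * v $ j - u $ j * v $ i) = u $ i * w $ j - u $ j * w $ i"
    by (simp_all add: algebra_simps)
  with j have s: "s = (w $ i * v $ j - w $ j * v $ i) / (u $ i * v $ j - u $ j * v $ i)"
    and t: "t = (u $ i * w $ j - u $ j * w $ i) / (u $ i * v $ j - u $ j * v $ i)"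
    by (simp_all add: eq_divide_eq)
  show "s \<in> F" "t \<in> F"
    unfolding s t by (intro is_subfield_divide[OF F] is_subfieldD(4,7)[OF F] uvw)+
qed

text \<open>\<open>n\<close> is the cross product. It is nonzero, so its kernel has dimension at
  most 2 and equals the span it contains.\<close>

lemma span_pair_kernel:
  fixes u v :: "'a::field ^ 3"
  assumes u: "u \<noteq> 0" and v: "\<And>t. v \<noteq> t *s u"
  defines "n \<equiv> vector [u $ 2 * v $ 3 - u $ 3 * v $ 2, u $ 3 * v $ 1 - u $ 1 * v $ 3, u $ 1 * v $ 2 - u $ 2 * v $ 1] :: 'a ^ 3"
  shows "vec.span {u, v} = {w. (\<Sum>i\<in>UNIV. n $ i * w $ i) = 0}"
proof (rule vec.subspace_dim_equal)
  let ?W = "{w. (\<Sum>i\<in>UNIV. n $ i * w $ i) = 0}"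
  show W: "vec.subspace ?W" by (rule functional_subspace)
  have "{u, v} \<subseteq> ?W" by (auto simp: n_def sum_3 algebra_simps)
  then show "vec.span {u, v} \<subseteq> ?W" using W by (rule vec.span_minimal)
  obtain k where k: "n $ k \<noteq> 0"
  proof (rule ccontr)
    assume "\<not> thesis"
    then have "n $ 1 = 0 \<and> n $ 2 = 0 \<and> n $ 3 = 0" using that by blast
    then have minors: "u $ 2 * v $ 3 = u $ 3 * v $ 2" "u $ 3 * v $ 1 = u $ 1 * v $ 3" "u $ 1 * v $ 2 = u $ 2 * v $ 1"
      by (simp_all add: n_def)
    obtain i where i: "u $ i \<noteq> 0" using u by (auto simp: vec_eq_iff)
    have "u $ i * v $ j = u $ j * v $ i" for j
      using minors exhaust_3[of i] exhaust_3[of j] by (auto simp: mult.commute)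
    then have "v = (v $ i / u $ i) *s u" using i by (auto simp: vec_eq_iff field_simps)
    with v show False by blast
  qed
  have "axis k 1 \<notin> ?W" using k by (simp add: axis_def if_distrib cong: if_cong)
  then have "?W \<noteq> UNIV" by blast
  moreover have "vec.dim ?W \<le> 3"
    using vec.dim_subset_UNIV[of ?W] by (simp add: vec.dimension_def card_cart_basis)
  moreover have "?W = UNIV" if "vec.dim ?W = 3"
    using W that by (intro vec.subspace_dim_equal) (simp_all add: card_cart_basis)
  ultimately have "vec.dim ?W \<le> 2" by linarith
  then show "vec.dim ?W \<le> vec.dim (vec.span {u, v})"
    using dim_pair[OF u v] by (simp add: vec.dim_span)
qed simp

text \<open>In contrast to \<open>vec.span\<close>, the scalars are restricted to
  \<open>F\<close>.\<close>

definition sub_span :: "'a::field set \<Rightarrow> 'a ^ 'n \<Rightarrow> 'a ^ 'n \<Rightarrow> ('a ^ 'n) set" where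
  "sub_span F u v = {s *s u + t *s v | s t. s \<in> F \<and> t \<in> F}"

lemma sub_spanI: "s \<in> F \<Longrightarrow> t \<in> F \<Longrightarrow> s *s u + t *s v \<in> sub_span F u v"
  unfolding sub_span_def by blast

lemma PG2_lines_eq:
  fixes F :: "'a::field set"
  shows "PG2_lines F = {proj_pt F ` (sub_span F u v - {0}) | u v.
    u \<in> vecs3 F - {0} \<and> v \<in> vecs3 F - {0} \<and> proj_pt F u \<noteq> proj_pt F v}"
  unfolding PG2_lines_def sub_span_def ..

text \<open>The cross product of \<open>u'\<close> and \<open>v'\<close> is defined over
  \<open>F\<close>, so a combination of \<open>u\<close> and \<open>v\<close> that it annihilates
  can be chosen with coefficients in \<open>F\<close>.\<close>

lemma sub_span_meets_span:
  fixes u v u' v' :: "'a::field ^ 3"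
  assumes F: "is_subfield F" and "u \<in> vecs3 F" "v \<in> vecs3 F" "u' \<in> vecs3 F" "v' \<in> vecs3 F"
    and u: "u \<noteq> 0" "\<And>t. v \<noteq> t *s u" and u': "u' \<noteq> 0" "\<And>t. v' \<noteq> t *s u'"
  obtains w where "w \<in> sub_span F u v" "w \<noteq> 0" "w \<in> vec.span {u', v'}"
proof -
  obtain n :: "'a ^ 3" where n: "\<And>i. n $ i \<in> F" and ker: "vec.span {u', v'} = {w. (\<Sum>i\<in>UNIV. n $ i * w $ i) = 0}"
  proof (rule that[OF _ span_pair_kernel[OF u']])
    show "vector [u' $ 2 * v' $ 3 - u' $ 3 * v' $ 2, u' $ 3 * v' $ 1 - u' $ 1 * v' $ 3, u' $ 1 * v' $ 2 - u' $ 2 * v' $ 1] $ i \<in> F" for i :: 3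
      using exhaust_3[of i] assms(4,5) by (auto simp: vecs3_def intro!: is_subfieldD(4,7)[OF F])
  qed
  define \<phi> where "\<phi> w = (\<Sum>i\<in>UNIV. n $ i * w $ i)" for w
  have \<phi>: "\<phi> w \<in> F" if "w \<in> vecs3 F" for w
    unfolding \<phi>_def
  proof (rule is_subfield_sum[OF F])
    show "n $ i * w $ i \<in> F" for i
      using is_subfieldD(4)[OF F n] that by (simp add: vecs3_def)
  qed
  have lin: "\<phi> (s *s w + t *s w') = s * \<phi> w + t * \<phi> w'" for s t w w'
    unfolding \<phi>_def by (simp add: algebra_simps sum.distrib sum_distrib_left)
  show thesis
  proof (cases "\<phi> u = 0")
    case True
    have "u \<in> sub_span F u v"
      using sub_spanI[OF is_subfieldD(2,1)[OF F], of u v] by simp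
    then show thesis by (rule that[OF _ u(1)]) (use True in \<open>simp add: ker \<phi>_def\<close>)
  next
    case False
    let ?w = "(- \<phi> v) *s u + \<phi> u *s v"
    have "?w \<in> sub_span F u v"
      by (intro sub_spanI is_subfieldD(5)[OF F] \<phi> assms(2,3))
    moreover have "?w \<noteq> 0"
    proof
      assume "?w = 0"
      then have "v = (\<phi> v / \<phi> u) *s u" using False by (auto simp: vec_eq_iff field_simps)
      with u(2) show False by blast
    qed
    moreover have "\<phi> ?w = 0" unfolding lin by simp
    then have "?w \<in> vec.span {u', v'}" unfolding ker \<phi>_def by simp
    ultimately show thesis by (rule that)
  qed
qed

section \<open>The plane of points with coordinates in a field \<open>F\<close> of constants\<close>

locale rational_plane = frame3 K b D
  for K :: "'a::field_char_0 set" and b :: "3 \<Rightarrow> 'a" and D +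
  fixes L F :: "'a set"
  assumes F: "is_subfield F" "F \<subseteq> alg_cl K"
    and in_geom: "\<And>v. v \<in> vecs3 F \<Longrightarrow> v \<noteq> 0 \<Longrightarrow> acl K {lincomb v} \<in> geom K L"
begin

definition pt :: "'a ^ 3 \<Rightarrow> 'a set" where "pt v = acl K {lincomb v}"

definition P :: "'a set set" where "P = pt ` (vecs3 F - {0})"

lemma dir_pt: "v \<in> vecs3 F - {0} \<Longrightarrow> dir (pt v) v"
  unfolding pt_def using F(2) by (intro dir_lincomb) (auto simp: vecs3_def)

lemma P_geom: "P \<subseteq> geom K L"
  unfolding P_def pt_def using in_geom by auto

lemma P_subset_M: "\<Union>P \<subseteq> M"
  unfolding P_def using dir_pt dir_subset_M by blast

lemma pt_eq: "u \<in> vecs3 F - {0} \<Longrightarrow> v \<in> vecs3 F - {0} \<Longrightarrow> pt u = pt v \<longleftrightarrow> (\<exists>t. v = t *s u)"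
  using dir_eq[OF dir_pt dir_pt] .

text \<open>A factor between two nonzero vectors over \<open>F\<close> is a ratio of coordinates,
  hence lies in \<open>F\<close>.\<close>

lemma proj_pt_eq:
  assumes u: "u \<in> vecs3 F - {0}" and v: "v \<in> vecs3 F - {0}"
  shows "proj_pt F u = proj_pt F v \<longleftrightarrow> pt u = pt v"
proof
  have "v = 1 *s v" by simp
  then have "v \<in> proj_pt F v" unfolding proj_pt_def using is_subfieldD(2)[OF F(1)] by force
  moreover assume "proj_pt F u = proj_pt F v"
  ultimately show "pt u = pt v" unfolding pt_eq[OF u v] proj_pt_def by blast
next
  assume "pt u = pt v"
  then obtain t where t: "v = t *s u" unfolding pt_eq[OF u v] ..
  obtain i where i: "u $ i \<noteq> 0" using u by (auto simp: vec_eq_iff)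
  have "t = v $ i / u $ i" using t i by simp
  then have "t \<in> F" using u v by (simp add: vecs3_def is_subfield_divide[OF F(1)])
  moreover have "t \<noteq> 0" using t v by auto
  ultimately have t': "t \<in> F - {0}" "inverse t \<in> F - {0}" using is_subfieldD(6)[OF F(1)] by auto
  have "\<exists>r\<in>F - {0}. s *s u = r *s v" if "s \<in> F - {0}" for s
    using that t' by (intro bexI[of _ "s * inverse t"]) (auto simp: t intro: is_subfieldD(4)[OF F(1)])
  moreover have "\<exists>r\<in>F - {0}. s *s v = r *s u" if "s \<in> F - {0}" for s
    using that t' by (intro bexI[of _ "s * t"]) (auto simp: t intro: is_subfieldD(4)[OF F(1)])
  ultimately show "proj_pt F u = proj_pt F v" unfolding proj_pt_def by blast
qed

lemma sub_span_vecs3: "u \<in> vecs3 F \<Longrightarrow> v \<in> vecs3 F \<Longrightarrow> sub_span F u v \<subseteq> vecs3 F"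
  unfolding sub_span_def vecs3_def by (auto intro!: is_subfieldD(3,4)[OF F(1)])

text \<open>By Cramer's rule, a vector over \<open>F\<close> in the ambient span is already a
  combination over \<open>F\<close>.\<close>

lemma line_points:
  assumes u: "u \<in> vecs3 F - {0}" and v: "v \<in> vecs3 F - {0}" and uv: "pt u \<noteq> pt v"
  shows "{r \<in> P. d ` r \<subseteq> vec.span {u, v}} = pt ` (sub_span F u v - {0})"
proof (intro equalityI subsetI)
  fix r assume "r \<in> {r \<in> P. d ` r \<subseteq> vec.span {u, v}}"
  then obtain w where w: "w \<in> vecs3 F - {0}" "r = pt w" "d ` r \<subseteq> vec.span {u, v}"
    unfolding P_def by blast
  then have "w \<in> vec.span {u, v}" using dir_subset_iff[OF dir_pt[OF w(1)]] by simp
  then obtain s t where st: "w = s *s u + t *s v" unfolding in_span_pair by blast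
  then have "s \<in> F" "t \<in> F"
    using lincomb_coeffs_in_subfield[OF F(1) _ _ _ _ _ st] u v w(1) uv pt_eq[OF u v]
    by (auto simp: vecs3_def)
  with st w show "r \<in> pt ` (sub_span F u v - {0})" unfolding sub_span_def by blast
next
  fix r assume "r \<in> pt ` (sub_span F u v - {0})"
  then obtain w where w: "w \<in> sub_span F u v" "w \<noteq> 0" "r = pt w" by blast
  then have w': "w \<in> vecs3 F - {0}" using sub_span_vecs3 u v by blast
  moreover have "w \<in> vec.span {u, v}" using w(1) unfolding sub_span_def in_span_pair by blast
  ultimately show "r \<in> {r \<in> P. d ` r \<subseteq> vec.span {u, v}}"
    using w(3) dir_subset_iff[OF dir_pt[OF w']] unfolding P_def by simp
qed

text \<open>The directions over \<open>F\<close> of the points of \<open>l\<close> span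
  \<open>V l\<close>, so a basis can be chosen among them.\<close>

lemma line_obtain:
  assumes l: "l \<in> lines_of K L P"
  obtains u v where "u \<in> vecs3 F - {0}" "v \<in> vecs3 F - {0}" "pt u \<noteq> pt v"
    "V l = vec.span {u, v}" "l = pt ` (sub_span F u v - {0})"
proof -
  have l': "l \<subseteq> P" "l = {p \<in> P. d ` p \<subseteq> V l}" "vec.dim (V l) = 2"
    using l lines_of_iff[OF P_geom P_subset_M] by blast+
  define S where "S = {u \<in> vecs3 F - {0}. pt u \<in> l}"
  have VS: "V l = vec.span S"
  proof
    show "V l \<subseteq> vec.span S"
    proof (rule V_minimal)
      fix p assume p: "p \<in> l"
      then obtain u where u: "u \<in> vecs3 F - {0}" "p = pt u" using l'(1) unfolding P_def by blast
      then have "u \<in> vec.span S" using p unfolding S_def by (intro vec.span_base) simp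
      then show "d ` p \<subseteq> vec.span S" using dir_subset_iff[OF dir_pt[OF u(1)]] u(2) by simp
    qed simp
    show "vec.span S \<subseteq> V l"
      by (rule vec.span_minimal[OF _ V_subspace]) (auto simp: S_def intro!: dir_in_V dir_pt)
  qed
  then have "vec.dim S = 2" using l'(3) by (simp add: vec.dim_span)
  then obtain u v where uv: "u \<in> S" "v \<in> S" "\<And>t. v \<noteq> t *s u" "vec.span S = vec.span {u, v}"
    by (rule dim_2_obtain) (rule that)
  then have R: "u \<in> vecs3 F - {0}" "v \<in> vecs3 F - {0}" unfolding S_def by auto
  have ne: "pt u \<noteq> pt v" using pt_eq[OF R] uv(3) by blast
  show thesis
    using that[OF R ne] VS uv(4) l'(2) line_points[OF R ne] by simp
qed

lemma line_intro:
  assumes "u \<in> vecs3 F - {0}" "v \<in> vecs3 F - {0}" "pt u \<noteq> pt v"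
  shows "pt ` (sub_span F u v - {0}) \<in> lines_of K L P"
  unfolding line_points[OF assms, symmetric]
  using line_through(1)[OF P_geom P_subset_M _ _ assms(3) dir_pt[OF assms(1)] dir_pt[OF assms(2)]] assms(1,2)
  unfolding P_def by blast

lemma axis_vecs3: "axis i 1 \<in> vecs3 F - {0}"
  using is_subfieldD(1,2)[OF F(1)] by (auto simp: vecs3_def axis_def vec_eq_iff)

lemma V_axes:
  assumes "\<And>i. pt (axis i 1) \<in> Y"
  shows "vec.dim (V Y) = 3"
proof -
  have "cart_basis \<subseteq> V Y"
    unfolding cart_basis_def using dir_in_V[OF dir_pt[OF axis_vecs3] assms] by auto
  then have "vec.span cart_basis \<subseteq> V Y" by (rule vec.span_minimal[OF _ V_subspace])
  then have "V Y = UNIV" by auto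
  then show ?thesis by (simp add: card_cart_basis)
qed

text \<open>The axis points are not collinear, a sum of two directions gives the third point of a
  line, and \<open>sub_span_meets_span\<close> gives the intersections.\<close>

lemma P_proj_plane: "is_proj_plane K L P"
  unfolding is_proj_plane_def
proof (intro conjI ballI)
  show "P \<subseteq> geom K L" by (rule P_geom)
  have axes: "pt (axis i 1) \<in> P" for i unfolding P_def using axis_vecs3 by blast
  then show "geom_rank K P = 3"
    by (simp add: geom_rank_eq[OF P_subset_M] V_axes numeral_eq_enat)
  have ne: "pt (axis i 1) \<noteq> pt (axis j 1)" if "i \<noteq> j" for i j
    unfolding pt_eq[OF axis_vecs3 axis_vecs3]
  proof
    assume "\<exists>t. axis j 1 = t *s (axis i 1 :: 'a ^ 3)"
    then obtain t where "axis j 1 = t *s (axis i 1 :: 'a ^ 3)" ..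
    then have "(axis j 1 :: 'a ^ 3) $ j = (t *s axis i 1) $ j" by simp
    then show False using that by (simp add: axis_def)
  qed
  have "\<not> {pt (axis 1 1), pt (axis 2 1), pt (axis 3 1)} \<subseteq> l" if "l \<in> lines_of K L P" for l
  proof
    assume "{pt (axis 1 1), pt (axis 2 1), pt (axis 3 1)} \<subseteq> l"
    then have "pt (axis i 1) \<in> l" for i using exhaust_3[of i] by auto
    then have "vec.dim (V l) = 3" by (rule V_axes)
    then show False using that unfolding lines_of_iff[OF P_geom P_subset_M] by simp
  qed
  then show "\<exists>p\<in>P. \<exists>q\<in>P. \<exists>r\<in>P. distinct [p, q, r] \<and> \<not> (\<exists>l\<in>lines_of K L P. {p, q, r} \<subseteq> l)"
    using ne axes
    by (intro bexI[of _ "pt (axis 1 1)"] bexI[of _ "pt (axis 2 1)"] bexI[of _ "pt (axis 3 1)"] conjI) auto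
next
  fix l assume "l \<in> lines_of K L P"
  then obtain u v where uv: "u \<in> vecs3 F - {0}" "v \<in> vecs3 F - {0}" "pt u \<noteq> pt v"
    "l = pt ` (sub_span F u v - {0})" by (rule line_obtain) (rule that)
  have not_mult: "v \<noteq> t *s u" for t using pt_eq[OF uv(1,2)] uv(3) by blast
  have S: "s *s u + t *s v \<in> sub_span F u v" if "s \<in> F" "t \<in> F" for s t
    using that by (rule sub_spanI)
  have "u \<in> sub_span F u v" "v \<in> sub_span F u v" "u + v \<in> sub_span F u v"
    using S[of 1 0] S[of 0 1] S[of 1 1] is_subfieldD(1,2)[OF F(1)] by simp_all
  moreover have nz: "u + v \<noteq> 0"
  proof
    assume "u + v = 0"
    then have "v = (- 1) *s u" by (auto simp: vec_eq_iff add_eq_0_iff)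
    with not_mult show False by blast
  qed
  ultimately have in_l: "pt u \<in> l" "pt v \<in> l" "pt (u + v) \<in> l" using uv by blast+
  have w: "u + v \<in> vecs3 F - {0}"
    using nz sub_span_vecs3[of u v] \<open>u + v \<in> sub_span F u v\<close> uv(1,2) by blast
  have "pt u \<noteq> pt (u + v)"
    unfolding pt_eq[OF uv(1) w]
  proof
    assume "\<exists>t. u + v = t *s u"
    then obtain t where "u + v = t *s u" ..
    then have "v = (t - 1) *s u" by (metis add_diff_cancel_left' vec.scale_left_diff_distrib vec.scale_one)
    with not_mult show False by blast
  qed
  moreover have "pt (u + v) \<noteq> pt v"
    unfolding pt_eq[OF w uv(2)]
  proof
    assume "\<exists>t. v = t *s (u + v)"
    then obtain t where t: "v = t *s (u + v)" ..
    then have "t \<noteq> 1" using uv(1) by auto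
    moreover have "v $ i = t * u $ i + t * v $ i" for i using arg_cong[OF t, of "\<lambda>x. x $ i"] by (simp add: algebra_simps)
    then have "v $ i * (1 - t) = t * u $ i" for i by (simp add: algebra_simps)
    ultimately have "v = (t / (1 - t)) *s u" by (simp add: vec_eq_iff eq_divide_eq)
    with not_mult show False by blast
  qed
  ultimately show "\<exists>p\<in>l. \<exists>q\<in>l. \<exists>r\<in>l. distinct [p, q, r]"
    using in_l uv(3)
    by (intro bexI[of _ "pt u"] bexI[of _ "pt v"] bexI[of _ "pt (u + v)"]) auto
next
  fix l m assume l: "l \<in> lines_of K L P" and m: "m \<in> lines_of K L P"
  obtain u v where uv: "u \<in> vecs3 F - {0}" "v \<in> vecs3 F - {0}" "pt u \<noteq> pt v"
    "l = pt ` (sub_span F u v - {0})" by (rule line_obtain[OF l]) (rule that)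
  obtain u' v' where uv': "u' \<in> vecs3 F - {0}" "v' \<in> vecs3 F - {0}" "pt u' \<noteq> pt v'"
    "m = pt ` (sub_span F u' v' - {0})" by (rule line_obtain[OF m]) (rule that)
  have n: "v \<noteq> t *s u" "v' \<noteq> t *s u'" for t
    using pt_eq[OF uv(1,2)] uv(3) pt_eq[OF uv'(1,2)] uv'(3) by blast+
  obtain w where w: "w \<in> sub_span F u v" "w \<noteq> 0" "w \<in> vec.span {u', v'}"
    by (rule sub_span_meets_span[OF F(1), of u v u' v']) (use uv uv' n in auto)
  then have "pt w \<in> l" using uv(4) by blast
  have w': "w \<in> vecs3 F - {0}" using w(1,2) sub_span_vecs3 uv(1,2) by blast
  then have "pt w \<in> {r \<in> P. d ` r \<subseteq> vec.span {u', v'}}"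
    using w(3) dir_subset_iff[OF dir_pt[OF w']] unfolding P_def by simp
  then have "pt w \<in> m" unfolding uv'(4) line_points[OF uv'(1-3)] .
  with \<open>pt w \<in> l\<close> show "l \<inter> m \<noteq> {}" by blast
qed

lemma P_coordinatised: "coordinatised_by K L P F"
  unfolding coordinatised_by_def
proof (intro conjI F(1))
  \<comment> \<open>\<open>SOME\<close> picks any coordinate vector; by \<open>proj_pt_eq\<close>
    the projective point does not depend on it.\<close>
  define f where "f p = proj_pt F (SOME v. v \<in> vecs3 F - {0} \<and> pt v = p)" for p
  have f_pt: "f (pt v) = proj_pt F v" if v: "v \<in> vecs3 F - {0}" for v
  proof -
    let ?w = "SOME w. w \<in> vecs3 F - {0} \<and> pt w = pt v"
    have "?w \<in> vecs3 F - {0} \<and> pt ?w = pt v" by (rule someI[of _ v]) (use v in simp)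
    then show ?thesis unfolding f_def using proj_pt_eq[of ?w v] v by blast
  qed
  have inj: "inj_on f P"
  proof (rule inj_onI)
    fix p q assume "p \<in> P" "q \<in> P" "f p = f q"
    then show "p = q" unfolding P_def using f_pt proj_pt_eq by auto
  qed
  have image: "f ` pt ` S = proj_pt F ` S" if "S \<subseteq> vecs3 F - {0}" for S
    unfolding image_image using that f_pt by (intro image_cong) auto
  have "f ` P = PG2 F" unfolding P_def PG2_def by (rule image) simp
  with inj have bij: "bij_betw f P (PG2 F)" unfolding bij_betw_def by simp
  have lines: "l \<in> lines_of K L P \<longleftrightarrow> f ` l \<in> PG2_lines F" if l: "l \<subseteq> P" for l
  proof
    assume "l \<in> lines_of K L P"
    then obtain u v where uv: "u \<in> vecs3 F - {0}" "v \<in> vecs3 F - {0}" "pt u \<noteq> pt v"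
      "l = pt ` (sub_span F u v - {0})" by (rule line_obtain) (rule that)
    have "sub_span F u v - {0} \<subseteq> vecs3 F - {0}" using sub_span_vecs3 uv(1,2) by blast
    then have "f ` l = proj_pt F ` (sub_span F u v - {0})" unfolding uv(4) by (rule image)
    moreover have "proj_pt F u \<noteq> proj_pt F v" using uv(3) proj_pt_eq[OF uv(1,2)] by simp
    ultimately show "f ` l \<in> PG2_lines F"
      using uv(1,2) unfolding PG2_lines_eq mem_Collect_eq by (intro exI[of _ u] exI[of _ v] conjI)
  next
    assume "f ` l \<in> PG2_lines F"
    then obtain u v where uv: "u \<in> vecs3 F - {0}" "v \<in> vecs3 F - {0}" "proj_pt F u \<noteq> proj_pt F v"
      "f ` l = proj_pt F ` (sub_span F u v - {0})"
      unfolding PG2_lines_eq mem_Collect_eq by (elim exE conjE) (rule that)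
    have S: "sub_span F u v - {0} \<subseteq> vecs3 F - {0}" using sub_span_vecs3 uv(1,2) by blast
    then have "f ` l = f ` pt ` (sub_span F u v - {0})" using image uv(4) by simp
    moreover have "pt ` (sub_span F u v - {0}) \<subseteq> P" unfolding P_def using S by blast
    ultimately have "l = pt ` (sub_span F u v - {0})" using inj_on_image_eq_iff[OF inj l] by simp
    then show "l \<in> lines_of K L P" using line_intro[OF uv(1,2)] uv(3) proj_pt_eq[OF uv(1,2)] by simp
  qed
  show "\<exists>f. bij_betw f P (PG2 F) \<and> (\<forall>l\<subseteq>P. l \<in> lines_of K L P \<longleftrightarrow> f ` l \<in> PG2_lines F)"
    by (intro exI[of _ f] conjI allI impI bij lines)
qed

end

section \<open>Existence of frames and the plane through the five given points\<close>

lemma alg_indep_subset: "alg_indep F B \<Longrightarrow> E \<subseteq> F \<Longrightarrow> alg_indep E B"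
  unfolding alg_indep_def by blast

text \<open>Independence provides, for each \<open>i\<close>, a derivation killing the other
  elements of \<open>b\<close> but not \<open>b i\<close>; dividing by its value at
  \<open>b i\<close> gives the dual system.\<close>

lemma exists_frame:
  fixes K :: "'a::field_char_0 set" and b :: "'n::finite \<Rightarrow> 'a"
  assumes K: "is_subfield K" and ind: "alg_indep K (range b)" "inj b"
  obtains D where "frame K b D"
proof -
  have "\<exists>D. D \<in> ders K \<and> (\<forall>j. D (b j) = (if i = j then 1 else 0))" for i
  proof -
    have "b i \<notin> acl K (range b - {b i})"
      by (rule alg_indep_imp_not_acl[OF K ind(1)]) auto
    then obtain E where E: "E \<in> ders K" "\<forall>s \<in> range b - {b i}. E s = 0" "E (b i) \<noteq> 0"
      unfolding acl_iff_ders by blast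
    have "(\<lambda>w. \<Sum>k\<in>{()}. 1 / E (b i) * E w) \<in> ders K" using E(1) by (intro ders_lincomb)
    moreover have "E (b j) = 0" if "i \<noteq> j" for j
      using that E(2) inj_eq[OF ind(2), of j i] by auto
    ultimately show ?thesis
      using E(3) by (intro exI[of _ "\<lambda>w. \<Sum>k\<in>{()}. 1 / E (b i) * E w"]) auto
  qed
  then obtain D where "\<And>i. D i \<in> ders K" "\<And>i j. D i (b j) = (if i = j then 1 else 0)" by metis
  then have "frame K b D" using K by unfold_locales
  then show thesis by (rule that)
qed

theorem theorem2p1:
  fixes K L :: "'a::{alg_closed_field, field_char_0} set"
    and x y z :: 'a
  assumes "is_subfield K" and "is_subfield L" and "K \<subseteq> L"
    and "tr_deg K L \<ge> 3"
    and "x \<in> alg_cl L" and "y \<in> alg_cl L" and "z \<in> alg_cl L"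
    and "distinct [x, y, z]" and "alg_indep (alg_cl K) {x, y, z}"
    and "acl K {x} \<in> geom K L" and "acl K {y} \<in> geom K L" and "acl K {z} \<in> geom K L"
    and "acl K {x + y} \<in> geom K L" and "acl K {x + z} \<in> geom K L"
  shows
    "let P = additive_plane K x y z \<inter> geom K L;
         Q = {acl K {x}, acl K {y}, acl K {z}, acl K {x + y}, acl K {x + z}}
     in P = {acl K {a * x + b * y + c * z} | a b c.
               a \<in> alg_cl K \<inter> L \<and> b \<in> alg_cl K \<inter> L \<and> c \<in> alg_cl K \<inter> L \<and>
               (a, b, c) \<noteq> (0, 0, 0)} \<and>
        is_proj_plane K L P \<and>
        coordinatised_by K L P (alg_cl K \<inter> L) \<and>
        Q \<subseteq> P \<and>
        (\<forall>X. is_proj_plane K L X \<and> Q \<subseteq> X \<longrightarrow> X \<subseteq> P)"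
proof -
  define b :: "3 \<Rightarrow> 'a" where "b = (\<lambda>i. if i = 1 then x else if i = 2 then y else z)"
  have b: "b 1 = x" "b 2 = y" "b 3 = z" by (simp_all add: b_def)
  have range: "range b = {x, y, z}" unfolding UNIV_3 by (simp add: b)
  have "alg_indep K (range b)"
    unfolding range by (rule alg_indep_subset[OF assms(9) alg_cl_superset[OF assms(1)]])
  moreover have "inj b" unfolding UNIV_3 using assms(8) by (simp add: b)
  ultimately obtain D where "frame K b D" by (rule exists_frame[OF assms(1)])
  then interpret frame3 K b D unfolding frame3_def .
  have k: "is_subfield (alg_cl K)" by (rule subfield_alg_cl)
  note k01 = is_subfieldD(1,2)[OF k]
  have lincomb_3: "lincomb v = v $ 1 * x + v $ 2 * y + v $ 3 * z" for v
    by (simp add: lincomb_def sum_3 b)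
  have lincomb_vector: "lincomb (vector [s, t, r]) = s * x + t * y + r * z" for s t r
    by (simp add: lincomb_3)
  have dir_vector: "dir (acl K {s * x + t * y + r * z}) (vector [s, t, r])"
    if "s \<in> alg_cl K" "t \<in> alg_cl K" "r \<in> alg_cl K" "(s, t, r) \<noteq> (0, 0, 0)" for s t r
    unfolding lincomb_vector[symmetric]
  proof (rule dir_lincomb)
    show "(vector [s, t, r] :: 'a ^ 3) $ i \<in> alg_cl K" for i
      using that exhaust_3[of i] by auto
    show "(vector [s, t, r] :: 'a ^ 3) \<noteq> 0" using that(4) by (auto simp: vec_eq_iff forall_3)
  qed
  have dirs: "dir (acl K {x}) (vector [1, 0, 0])" "dir (acl K {y}) (vector [0, 1, 0])"
    "dir (acl K {z}) (vector [0, 0, 1])" "dir (acl K {x + y}) (vector [1, 1, 0])"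
    "dir (acl K {x + z}) (vector [1, 0, 1])"
    using dir_vector[of 1 0 0] dir_vector[of 0 1 0] dir_vector[of 0 0 1]
      dir_vector[of 1 1 0] dir_vector[of 1 0 1] k01 by simp_all
  have rep: "\<exists>l\<in>L. l \<in> M \<and> (\<exists>t. t \<noteq> 0 \<and> (\<forall>i. D i l = t * v $ i))"
    if p: "p \<in> geom K L" "dir p v" for p v
  proof -
    obtain w l where l: "dir p w" "l \<in> L" "p = acl K {l}" "d l = w"
      by (rule geom_dir[OF p(1) dir_subset_M[OF p(2)]]) (rule that)
    obtain t where t: "t \<noteq> 0" "w = t *s v" using dir_mult[OF p(2) l(1)] by blast
    have "l \<in> M" using l(3) dir_subset_M[OF p(2)] acl_superset(2)[of "{l}" K] by auto
    moreover have "\<forall>i. D i l = t * v $ i" using l(4) t(2) by (simp add: d_nth[symmetric])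
    ultimately show ?thesis using l(2) t(1) by blast
  qed
  have "\<exists>l. l \<in> L \<and> l \<in> M \<and> (\<forall>j. D j l \<noteq> 0 \<longleftrightarrow> j = i)" for i
  proof -
    have "acl K {b i} \<in> geom K L \<and> dir (acl K {b i}) (axis i 1)"
      using exhaust_3[of i] dirs assms(10-12) by (auto simp: b vector_3_axis)
    then obtain l t where "l \<in> L" "l \<in> M" "t \<noteq> 0" "\<forall>j. D j l = t * axis i 1 $ j"
      using rep by blast
    then show ?thesis by (intro exI[of _ l]) (auto simp: axis_def)
  qed
  then obtain \<Lambda> where \<Lambda>: "\<And>i. \<Lambda> i \<in> L" "\<And>i. \<Lambda> i \<in> M" "\<And>i j. D j (\<Lambda> i) \<noteq> 0 \<longleftrightarrow> j = i" by metis
  have "\<exists>l. l \<in> L \<and> l \<in> M \<and> D i l = D 1 l \<and> D i l \<noteq> 0" for i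
  proof -
    \<comment> \<open>The points of \<open>x\<close>, \<open>x + y\<close> and \<open>x + z\<close>
      serve for the indices 1, 2 and 3.\<close>
    have "\<exists>p v. p \<in> geom K L \<and> dir p v \<and> v $ i = 1 \<and> v $ 1 = 1"
      using exhaust_3[of i] dirs(1,4,5) assms(10,13,14) by (metis vector_3)
    then obtain l t v where "l \<in> L" "l \<in> M" "t \<noteq> 0" "\<forall>j. D j l = t * v $ j" "v $ i = 1" "v $ 1 = 1"
      using rep by blast
    then show ?thesis by (intro exI[of _ l]) auto
  qed
  then obtain \<mu> where \<mu>: "\<And>i. \<mu> i \<in> L" "\<And>i. \<mu> i \<in> M" "\<And>i. D i (\<mu> i) = D 1 (\<mu> i)" "\<And>i. D i (\<mu> i) \<noteq> 0"
    by metis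
  interpret rat: rational_frame K b D L \<Lambda> \<mu> 1
    by unfold_locales (use assms(2,3) \<Lambda> \<mu> in auto)
  let ?F = "alg_cl K \<inter> L"
  have F: "is_subfield ?F" using is_subfield_Inter[of "{alg_cl K, L}"] k assms(2) by auto
  interpret plane: rational_plane K b D L ?F
  proof
    show "acl K {lincomb v} \<in> geom K L" if "v \<in> vecs3 ?F" "v \<noteq> 0" for v
      using that by (intro rat.lincomb_in_geom) (auto simp: vecs3_def)
  qed (use F in auto)
  let ?P = "additive_plane K x y z \<inter> geom K L"
  let ?R = "{acl K {a * x + b * y + c * z} | a b c. a \<in> ?F \<and> b \<in> ?F \<and> c \<in> ?F \<and> (a, b, c) \<noteq> (0, 0, 0)}"
  have R: "?R = plane.P"
  proof (intro equalityI subsetI)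
    fix p assume "p \<in> ?R"
    then obtain s t r where p: "p = acl K {s * x + t * y + r * z}" "s \<in> ?F" "t \<in> ?F" "r \<in> ?F" "(s, t, r) \<noteq> (0, 0, 0)"
      by blast
    have "vector [s, t, r] \<in> vecs3 ?F - {0}"
      using p(2-5) by (auto simp: vecs3_def vec_eq_iff forall_3)
    moreover have "p = plane.pt (vector [s, t, r])" unfolding plane.pt_def lincomb_vector p(1) ..
    ultimately show "p \<in> plane.P" unfolding plane.P_def by blast
  next
    fix p assume "p \<in> plane.P"
    then obtain v where v: "v \<in> vecs3 ?F - {0}" "p = plane.pt v" unfolding plane.P_def by blast
    have "p = acl K {v $ 1 * x + v $ 2 * y + v $ 3 * z}" using v(2) unfolding plane.pt_def lincomb_3 .
    moreover have "v $ 1 \<in> ?F" "v $ 2 \<in> ?F" "v $ 3 \<in> ?F" "(v $ 1, v $ 2, v $ 3) \<noteq> (0, 0, 0)"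
      using v(1) by (auto simp: vecs3_def vec_eq_iff forall_3)
    ultimately show "p \<in> ?R" by blast
  qed
  have P: "?P = plane.P"
  proof (intro equalityI subsetI)
    fix p assume "p \<in> ?P"
    then obtain s t r where p: "p = acl K {s * x + t * y + r * z}" "s \<in> alg_cl K" "t \<in> alg_cl K"
      "r \<in> alg_cl K" "(s, t, r) \<noteq> (0, 0, 0)" "p \<in> geom K L"
      unfolding additive_plane_def by blast
    define v :: "'a ^ 3" where "v = vector [s, t, r]"
    have v: "dir p v" unfolding v_def p(1) by (rule dir_vector[OF p(2-5)])
    have vk: "v $ i \<in> alg_cl K" for i using p(2-4) exhaust_3[of i] by (auto simp: v_def)
    obtain j where j: "v $ j \<noteq> 0" using dir_nz[OF v] by (auto simp: vec_eq_iff)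
    \<comment> \<open>Scaling one coordinate to 1 turns the others into ratios, which
      \<open>dir_ratio_in_L\<close> places in \<open>L\<close>.\<close>
    define w where "w = (1 / v $ j) *s v"
    have w: "w \<in> vecs3 ?F"
      unfolding vecs3_def
    proof (intro CollectI allI IntI)
      show "w $ i \<in> alg_cl K" for i using is_subfield_divide[OF k vk vk] by (simp add: w_def)
      show "w $ i \<in> L" for i using rat.dir_ratio_in_L[OF p(6) v j] by (simp add: w_def)
    qed
    have "w $ j = 1" using j by (simp add: w_def)
    then have w0: "w \<in> vecs3 ?F - {0}" using w by auto
    have "p = plane.pt w" using dir_eq[OF v plane.dir_pt[OF w0]] w_def by blast
    with w0 show "p \<in> plane.P" unfolding plane.P_def by blast
  next
    fix p assume p: "p \<in> plane.P"
    then have "p \<in> additive_plane K x y z" unfolding R[symmetric] additive_plane_def by blast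
    with p plane.P_geom show "p \<in> ?P" by blast
  qed
  have Q: "{acl K {x}, acl K {y}, acl K {z}, acl K {x + y}, acl K {x + z}} \<subseteq> ?P"
  proof -
    have additive: "acl K {s * x + t * y + r * z} \<in> additive_plane K x y z"
      if "s \<in> alg_cl K" "t \<in> alg_cl K" "r \<in> alg_cl K" "(s, t, r) \<noteq> (0, 0, 0)" for s t r
      using that unfolding additive_plane_def by blast
    show ?thesis
      using additive[of 1 0 0] additive[of 0 1 0] additive[of 0 0 1] additive[of 1 1 0]
        additive[of 1 0 1] k01 assms(10-14) by simp
  qed
  have max: "X \<subseteq> ?P"
    if X: "is_proj_plane K L X" "{acl K {x}, acl K {y}, acl K {z}, acl K {x + y}, acl K {x + z}} \<subseteq> X" for X
  proof
    fix p assume p: "p \<in> X"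
    have X': "X \<subseteq> geom K L" "geom_rank K X = 3" using X(1) unfolding is_proj_plane_def by simp_all
    have "b i \<in> \<Union>X" for i
      using exhaust_3[of i] X(2) acl_superset(2)[of "{b i}" K] by (auto simp: b)
    \<comment> \<open>Since \<open>X\<close> has rank 3 and contains the points of \<open>x\<close>,
      \<open>y\<close>, \<open>z\<close>, it lies in their closure, where directions are
      available.\<close>
    then have XM: "\<Union>X \<subseteq> M"
      using X'(2) by (intro subset_M_if_tr_deg_le) (auto simp: geom_rank_def numeral_eq_enat)
    have "has_dir X 1 0 0" "has_dir X 0 1 0" "has_dir X 0 0 1" "has_dir X 1 1 0" "has_dir X 1 0 1"
      unfolding has_dir_def using X(2) dirs by blast+
    then obtain v where v: "dir p v" "\<And>i. v $ i \<in> alg_cl K"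
      by (rule plane_rational_dir[OF X(1) XM _ _ _ _ _ p]) (rule that)
    have "v = 1 *s v" by simp
    then have "p = acl K {lincomb v}"
      using dir_eq[OF v(1) dir_lincomb[OF v(2) dir_nz[OF v(1)]]] by blast
    moreover have "(v $ 1, v $ 2, v $ 3) \<noteq> (0, 0, 0)"
      using dir_nz[OF v(1)] by (auto simp: vec_eq_iff forall_3)
    ultimately have "p \<in> additive_plane K x y z"
      using v(2) unfolding additive_plane_def lincomb_3 by blast
    with X'(1) p show "p \<in> ?P" by blast
  qed
  show ?thesis
    unfolding Let_def
    using P R Q max plane.P_proj_plane plane.P_coordinatised by simp
qed

end
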